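(* Let $l\in\{0,1,2,3,4\}$ and let $w$ be an even integer with $0\leq 2l\leq w$ and $2l\neq w-2$. Then a non-zero quasi-modular form $f$ of weight $w$ and depth $l$ is algebraically extremal, i.e. satisfies $\nu(f)=\delta_l(w)-1$, if and only if it is analytically extremal, i.e. satisfies $\nu(f)=\nu_{\max}(l,w)$.
   Context: Let $q=e^{2\pi i z}$ for $z$ in the complex upper half-plane, and let $E_2=1-24\sum_{n\ge1}\sigma_1(n)q^n$, $E_4=1+240\sum_{n\ge1}\sigma_3(n)q^n$, $E_6=1-504\sum_{n\ge1}\sigma_5(n)q^n$ be the Eisenstein series, where $\sigma_k(n)=\sum_{d\mid n}d^k$. These are algebraically independent and $\mathbb{C}[E_2,E_4,E_6]$ is graded by giving $E_2,E_4,E_6$ weights $2,4,6$. A quasi-modular form of weight $w$ is an element of $\mathbb{C}[E_2,E_4,E_6]$ homogeneous of weight $w$; a non-zero such $f$ can be written uniquely as $f=f_0+f_1E_2+\cdots+f_lE_2^l$ with $f_i$ a modular form (for $\mathrm{SL}_2(\mathbb{Z})$) of weight $w-2i$ and $f_l\neq0$; $l$ is the depth of $f$. Let $\widetilde{M}^{\leq l}_w$ be the space of quasi-modular forms of weight $w$ and depth $\leq l$ (together with $0$). Quasi-modular forms are identified with their $q$-expansions in $\mathbb{C}[[q]]$, and $\nu(f)$ denotes the order of vanishing at $q=0$ of $f$. Let $d(w)$ be the dimension of the space of modular forms of weight $w$ for $\mathrm{SL}_2(\mathbb{Z})$: $d(w)=0$ if $w<0$, $d(w)=\lfloor w/12\rfloor$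 if $w\ge0$ and $w\equiv 2\pmod{12}$, and $d(w)=\lfloor w/12\rfloor+1$ otherwise (for even $w\geq 0$). Set $\delta_l(w)=\sum_{i=0}^l d(w-2i)=\dim\widetilde{M}^{\leq l}_w$. When $\widetilde{M}^{\leq l}_w\neq\{0\}$, set $\nu_{\max}(l,w)=\max\{\nu(f): f\in \widetilde{M}^{\leq l}_w\setminus\{0\}\}$. *)

theory Defs
  imports Complex_Main "HOL-Computational_Algebra.Formal_Power_Series"
begin

text \<open>
  Quasi-modular forms are identified with their \<open>q\<close>-expansions, i.e. they are elements of
  \<^typ>\<open>complex fps\<close>; the order of vanishing at \<open>q = 0\<close> of a non-zero series is its
  \<^const>\<open>subdegree\<close>.
\<close>

definition divisor_power_sum :: "nat \<Rightarrow> nat \<Rightarrow> nat" where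
  "divisor_power_sum k n = (\<Sum>d | d dvd n. d ^ k)"

definition E2 :: "complex fps" where
  "E2 = Abs_fps (\<lambda>n. if n = 0 then 1 else - 24 * of_nat (divisor_power_sum 1 n))"

definition E4 :: "complex fps" where
  "E4 = Abs_fps (\<lambda>n. if n = 0 then 1 else 240 * of_nat (divisor_power_sum 3 n))"

definition E6 :: "complex fps" where
  "E6 = Abs_fps (\<lambda>n. if n = 0 then 1 else - 504 * of_nat (divisor_power_sum 5 n))"

global_interpretation fps_vs: vector_space "\<lambda>(c :: complex) (f :: complex fps). fps_const c * f"
  by standard (simp_all add: algebra_simps flip: fps_const_add fps_const_mult)

text \<open>
  Homogeneous elements of weight \<open>w\<close> in \<open>\<complex>[E\<^sub>2, E\<^sub>4, E\<^sub>6]\<close>. Weights are integers, so that differences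
  such as \<open>w - 2i\<close> are not truncated.
\<close>

definition quasi_modular_forms :: "int \<Rightarrow> complex fps set" where
  "quasi_modular_forms w =
     fps_vs.span {E2 ^ a * E4 ^ b * E6 ^ c | a b c. 2 * int a + 4 * int b + 6 * int c = w}"

text \<open>
  The modular forms for \<open>SL\<^sub>2(\<int>)\<close> of weight \<open>k\<close>, as homogeneous elements of weight \<open>k\<close> in
  \<open>\<complex>[E\<^sub>4, E\<^sub>6]\<close>. The coefficients of an element of \<open>\<complex>[E\<^sub>2, E\<^sub>4, E\<^sub>6]\<close> with respect to the powers
  of \<open>E\<^sub>2\<close> lie in this ring.
\<close>

definition modular_forms :: "int \<Rightarrow> complex fps set" where
  "modular_forms k = fps_vs.span {E4 ^ b * E6 ^ c | b c. 4 * int b + 6 * int c = k}"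

definition has_depth :: "int \<Rightarrow> complex fps \<Rightarrow> nat \<Rightarrow> bool" where
  "has_depth w f l \<longleftrightarrow>
     (\<exists>g :: nat \<Rightarrow> complex fps.
        (\<forall>i\<le>l. g i \<in> modular_forms (w - 2 * int i)) \<and> g l \<noteq> 0 \<and>
        f = (\<Sum>i\<le>l. g i * E2 ^ i))"

definition quasi_modular_forms_le :: "nat \<Rightarrow> int \<Rightarrow> complex fps set" where
  "quasi_modular_forms_le l w =
     {f \<in> quasi_modular_forms w. f = 0 \<or> (\<exists>k\<le>l. has_depth w f k)}"

text \<open>The value at odd \<open>w\<close>, where there are no non-zero modular forms, is set to \<open>0\<close>.\<close>

definition dim_modular :: "int \<Rightarrow> nat" where
  "dim_modular w =
     (if w < 0 \<or> odd w then 0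
      else if w mod 12 = 2 then nat (w div 12)
      else nat (w div 12) + 1)"

definition \<delta> :: "nat \<Rightarrow> int \<Rightarrow> nat" where
  "\<delta> l w = (\<Sum>i\<le>l. dim_modular (w - 2 * int i))"

definition \<nu>_max :: "nat \<Rightarrow> int \<Rightarrow> nat" where
  "\<nu>_max l w = Max (subdegree ` (quasi_modular_forms_le l w - {0}))"

definition algebraically_extremal :: "nat \<Rightarrow> int \<Rightarrow> complex fps \<Rightarrow> bool" where
  "algebraically_extremal l w f \<longleftrightarrow> int (subdegree f) = int (\<delta> l w) - 1"

definition analytically_extremal :: "nat \<Rightarrow> int \<Rightarrow> complex fps \<Rightarrow> bool" where
  "analytically_extremal l w f \<longleftrightarrow> subdegree f = \<nu>_max l w"

end

(* A quasi-modular form f of weight w and depth at most l is P(E2) for a polynomial P of degree at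
   most l over the modular forms.  The operator theta - (w - l) E2, where theta = 12 q d/dq, acts on
   such P by Ramanujan's differential equations.  The determinant of the coefficients of P and of its
   first l iterates is a modular form of weight (l + 1) w.  After the substitution X = E2 + Y the first
   column of the matrix consists of iterates of f, so the determinant vanishes at q = 0 to at least the
   order of f, and it is non-zero by a Wronskian argument.  Hence the order of f is less than
   d((l + 1) w), and for l <= 4 this is at most delta_l(w).  Conversely E2 is transcendental over the
   modular forms, so the forms of weight w and depth at most l form a space of dimension delta_l(w),
   which contains a non-zero form of order at least delta_l(w) - 1. *)
theory Submission
  imports Defs "Jordan_Normal_Form.Determinant"
begin

unbundle fps_syntax
no_notation vec_index (infixl "$" 100)

section \<open>Sums over the solutions of \<open>a x + b y = n\<close>\<close>

text \<open>Everything here is a formal power series, so neither the upper half-plane nor a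
  transformation law is at hand. Ramanujan's equations are therefore drawn from Liouville's
  elementary identities for divisor sums, and division by \<open>Delta\<close> stands in for the
  valence formula.

  The determinant is a Wronskian in disguise. With t = (log q)/12 one has \<open>theta\<close> t =
  1, and conjugation by the exponential of a nilpotent shift times t turns the iterates into plain
  derivatives of combinations of power series with powers of log q. Keeping the shift inside the
  recursion avoids the logarithms; what remains of them is that no quotient of two power series has
  a non-zero constant as its \<open>theta\<close>. This one obstruction serves both the Wronskian
  argument and the transcendence of \<open>E2\<close>.

  Two expansions of the same polynomial are needed: in powers of X the coefficients are modular, in
  powers of Y = X - \<open>E2\<close> the constant coefficient is the quasi-modular form itself. The
  change of basis is unipotent, so one determinant inherits both properties.\<close>

definition decomps :: "nat \<Rightarrow> (nat \<times> nat \<times> nat \<times> nat) set" where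
  "decomps n = {(a, b, x, y). 0 < a \<and> 0 < b \<and> 0 < x \<and> 0 < y \<and> a * x + b * y = n}"

lemma finite_decomps: "finite (decomps n)"
proof (rule finite_subset)
  show "decomps n \<subseteq> {..n} \<times> {..n} \<times> {..n} \<times> {..n}"
  proof
    fix t assume "t \<in> decomps n"
    then obtain a b x y where t: "t = (a, b, x, y)"
      and pos: "0 < a" "0 < b" "0 < x" "0 < y" and eq: "a * x + b * y = n"
      by (auto simp: decomps_def)
    have "a \<le> a * x" "x \<le> a * x" "b \<le> b * y" "y \<le> b * y"
      using pos by simp_all
    then show "t \<in> {..n} \<times> {..n} \<times> {..n} \<times> {..n}"
      unfolding t eq[symmetric] by (auto intro: trans_le_add1 trans_le_add2)
  qed
qed simp

lemma sum_decomps_swap: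
  "(\<Sum>(a, b, x, y) | (a, b, x, y) \<in> decomps n \<and> P a b x y. g a b x y) =
   (\<Sum>(a, b, x, y) | (a, b, x, y) \<in> decomps n \<and> P b a y x. g b a y x)"
  by (rule sum.reindex_bij_witness[where i = "\<lambda>(a, b, x, y). (b, a, y, x)"
        and j = "\<lambda>(a, b, x, y). (b, a, y, x)"]) (auto simp: decomps_def)

text \<open>Liouville's substitution: (a - b) x + b (x + y) = a x + b y, so trading a for a - b and
  y for x + y stays among the solutions and exchanges the condition b < a for x < y.\<close>

lemma sum_decomps_shift:
  "(\<Sum>(a, b, x, y) | (a, b, x, y) \<in> decomps n \<and> b < a. g (int a - int b) (int b)) =
   (\<Sum>(a, b, x, y) | (a, b, x, y) \<in> decomps n \<and> x < y. g (int a) (int b))"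
  by (rule sum.reindex_bij_witness[where i = "\<lambda>(a, b, x, y). (a + b, b, x, y - x)"
        and j = "\<lambda>(a, b, x, y). (a - b, b, x, x + y)"])
    (auto simp: decomps_def algebra_simps of_nat_diff
      intro!: le_add_diff_inverse trans_le_add1 mult_le_mono1)

lemma sum_decomps_trichotomy:
  fixes g :: "nat \<Rightarrow> nat \<Rightarrow> nat \<Rightarrow> nat \<Rightarrow> 'a::comm_monoid_add" and u v :: "nat \<Rightarrow> nat \<Rightarrow> nat \<Rightarrow> nat \<Rightarrow> nat"
  shows "(\<Sum>(a, b, x, y)\<in>decomps n. g a b x y) =
    (\<Sum>(a, b, x, y) | (a, b, x, y) \<in> decomps n \<and> u a b x y < v a b x y. g a b x y) +
    (\<Sum>(a, b, x, y) | (a, b, x, y) \<in> decomps n \<and> v a b x y < u a b x y. g a b x y) +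
    (\<Sum>(a, b, x, y) | (a, b, x, y) \<in> decomps n \<and> u a b x y = v a b x y. g a b x y)"
proof -
  define A where "A = {(a, b, x, y). (a, b, x, y) \<in> decomps n \<and> u a b x y < v a b x y}"
  define B where "B = {(a, b, x, y). (a, b, x, y) \<in> decomps n \<and> v a b x y < u a b x y}"
  define C where "C = {(a, b, x, y). (a, b, x, y) \<in> decomps n \<and> u a b x y = v a b x y}"
  have fin: "finite A" "finite B" "finite C"
    by (auto intro: finite_subset[OF _ finite_decomps[of n]] simp: A_def B_def C_def)
  have "decomps n = (A \<union> B) \<union> C" by (auto simp: A_def B_def C_def)
  moreover have "A \<inter> B = {}" "(A \<union> B) \<inter> C = {}" by (auto simp: A_def B_def C_def)
  ultimately show ?thesis
    using fin unfolding A_def[symmetric] B_def[symmetric] C_def[symmetric]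
    by (simp add: sum.union_disjoint)
qed

text \<open>The polynomials satisfying the hypotheses are those in \<open>a\<^sup>2 + a b + b\<^sup>2\<close> and \<open>(a b (a + b))\<^sup>2\<close>.
  The ones of degree 2, 4 and 6 give all the convolution identities behind Ramanujan's equations.\<close>

lemma sum_decomps_invariant:
  fixes h :: "int \<Rightarrow> int \<Rightarrow> 'a::comm_ring_1"
  assumes sym: "\<And>a b. h a b = h b a" and ev: "\<And>a b. h (- a) (- b) = h a b"
    and rot: "\<And>a b. h a (- a - b) = h a b"
  shows "(\<Sum>(a, b, x, y)\<in>decomps n. h (int a) (int b) - h (int a - int b) (int b)) =
    (\<Sum>(a, b, x, y) | (a, b, x, y) \<in> decomps n \<and> x = y. h (int a) (int b)) -
    (\<Sum>(a, b, x, y) | (a, b, x, y) \<in> decomps n \<and> a = b. h 0 (int b))"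
proof -
  let ?S = "\<lambda>P. \<Sum>(a, b, x, y) | (a, b, x, y) \<in> decomps n \<and> P a b x y. h (int a) (int b)"
  let ?T = "\<lambda>P. \<Sum>(a, b, x, y) | (a, b, x, y) \<in> decomps n \<and> P a b x y. h (int a - int b) (int b)"
  \<comment> \<open>The sheared function h(a - b, b) is again symmetric: by evenness h(b - a, a) is
    h(a - b, -a), and \<open>rot\<close> turns that into h(a - b, b).\<close>
  have k: "h (int b - int a) (int a) = h (int a - int b) (int b)" for a b
    using ev[of "int b - int a" "int a"] rot[of "int a - int b" "int b"] by simp
  have 1: "?S (\<lambda>a b x y. y < x) = ?S (\<lambda>a b x y. x < y)"
    by (subst sum_decomps_swap) (simp add: sym)
  have 2: "?T (\<lambda>a b x y. a < b) = ?T (\<lambda>a b x y. b < a)"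
    by (subst sum_decomps_swap) (simp add: k)
  have 3: "?T (\<lambda>a b x y. b < a) = ?S (\<lambda>a b x y. x < y)"
    by (rule sum_decomps_shift)
  have 4: "?T (\<lambda>a b x y. a = b) = (\<Sum>(a, b, x, y) | (a, b, x, y) \<in> decomps n \<and> a = b. h 0 (int b))"
    by (rule sum.cong) auto
  have "(\<Sum>(a, b, x, y)\<in>decomps n. h (int a) (int b)) =
      ?S (\<lambda>a b x y. x < y) + ?S (\<lambda>a b x y. y < x) + ?S (\<lambda>a b x y. x = y)"
    by (rule sum_decomps_trichotomy)
  moreover have "(\<Sum>(a, b, x, y)\<in>decomps n. h (int a - int b) (int b)) =
      ?T (\<lambda>a b x y. a < b) + ?T (\<lambda>a b x y. b < a) + ?T (\<lambda>a b x y. a = b)"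
    by (rule sum_decomps_trichotomy)
  moreover have "(\<Sum>(a, b, x, y)\<in>decomps n. h (int a) (int b) - h (int a - int b) (int b)) =
      (\<Sum>(a, b, x, y)\<in>decomps n. h (int a) (int b)) -
      (\<Sum>(a, b, x, y)\<in>decomps n. h (int a - int b) (int b))"
    by (simp add: sum_subtractf case_prod_unfold)
  ultimately show ?thesis
    unfolding 1 2 3 4 by simp
qed

text \<open>If x = y, the equation is (a + b) x = n, so d = a + b runs over the divisors of n and a
  is free below d.\<close>

lemma sum_decomps_eq_right:
  "(\<Sum>(a, b, x, y) | (a, b, x, y) \<in> decomps n \<and> x = y. g a b) =
   (\<Sum>d | d dvd n. \<Sum>a = 1..<d. g a (d - a))"
proof (cases "n = 0")
  case True
  then show ?thesis by (auto simp: decomps_def intro!: sum.neutral)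
next
  case False
  then have fin: "finite {d. d dvd n}" by simp
  have "(\<Sum>d | d dvd n. \<Sum>a = 1..<d. g a (d - a)) =
    (\<Sum>(d, a)\<in>Sigma {d. d dvd n} (\<lambda>d. {1..<d}). g a (d - a))"
    by (rule sum.Sigma) (use fin in auto)
  also have "\<dots> = (\<Sum>(a, b, x, y) | (a, b, x, y) \<in> decomps n \<and> x = y. g a b)"
    by (rule sum.reindex_bij_witness[where i = "\<lambda>(a, b, x, y). (a + b, a)"
          and j = "\<lambda>(d, a). (a, d - a, n div d, n div d)"])
      (use False in \<open>auto simp: decomps_def simp flip: distrib_right intro: gr0I\<close>)
  finally show ?thesis ..
qed

text \<open>If a = b = d, the equation is x + y = n / d, which has n / d - 1 positive
  solutions.\<close>

lemma sum_decomps_eq_left: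
  "(\<Sum>(a, b, x, y) | (a, b, x, y) \<in> decomps n \<and> a = b. g b) =
   (\<Sum>d | d dvd n. of_nat (n div d - 1) * (g d :: 'a::comm_ring_1))"
proof (cases "n = 0")
  case True
  then show ?thesis by (auto simp: decomps_def intro!: sum.neutral)
next
  case False
  then have fin: "finite {d. d dvd n}" by simp
  have le: "d * x + (n - d * x) = n" if "x < n div d" for d x
  proof -
    have "d * x \<le> n"
      using that by (metis div_times_less_eq_dividend le_trans less_imp_le mult.commute mult_le_mono2)
    then show ?thesis by simp
  qed
  have "(\<Sum>d | d dvd n. \<Sum>x = 1..<n div d. g d) =
    (\<Sum>(d, x)\<in>Sigma {d. d dvd n} (\<lambda>d. {1..<n div d}). g d)"
    by (rule sum.Sigma) (use fin in auto)
  also have "\<dots> = (\<Sum>(a, b, x, y) | (a, b, x, y) \<in> decomps n \<and> a = b. g b)"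
    by (rule sum.reindex_bij_witness[where i = "\<lambda>(a, b, x, y). (a, x)"
          and j = "\<lambda>(d, x). (d, d, x, n div d - x)"])
      (use False in \<open>auto simp: decomps_def algebra_simps le simp flip: distrib_left
        intro: gr0I\<close>)
  finally show ?thesis by simp
qed

text \<open>The constant term is 0: every natural number divides 0, and a sum over an infinite set
  is 0 by convention.\<close>

definition sigma_fps :: "nat \<Rightarrow> complex fps" where
  "sigma_fps k = Abs_fps (\<lambda>n. of_nat (divisor_power_sum k n))"

text \<open>A solution of a x + b y = n encodes a splitting n = m + (n - m) with m = a x, together
  with a divisor a of m and a divisor b of n - m.\<close>

lemma sigma_fps_mult_nth:
  "(sigma_fps i * sigma_fps j) $ n =
    (\<Sum>(a, b, x, y)\<in>decomps n. of_nat a ^ i * of_nat b ^ j)"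
proof -
  let ?D = "\<lambda>m::nat. {d. d dvd m}"
  have 0: "(\<Sum>d\<in>?D 0. g d) = (0::complex)" for g
    by (simp add: infinite_UNIV_nat)
  have "(sigma_fps i * sigma_fps j) $ n =
      (\<Sum>m\<in>{0..n}. (\<Sum>a\<in>?D m. of_nat a ^ i) * (\<Sum>b\<in>?D (n - m). of_nat b ^ j))"
    by (simp add: fps_mult_nth sigma_fps_def divisor_power_sum_def)
  also have "\<dots> = (\<Sum>m\<in>{0<..<n}. (\<Sum>a\<in>?D m. of_nat a ^ i) * (\<Sum>b\<in>?D (n - m). of_nat b ^ j))"
    by (rule sum.mono_neutral_right) (auto simp: 0 infinite_UNIV_nat)
  also have "\<dots> = (\<Sum>m\<in>{0<..<n}. \<Sum>(a, b)\<in>?D m \<times> ?D (n - m). of_nat a ^ i * of_nat b ^ j)"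
    by (simp add: sum_product sum.cartesian_product)
  also have "\<dots> = (\<Sum>(m, a, b)\<in>Sigma {0<..<n} (\<lambda>m. ?D m \<times> ?D (n - m)). of_nat a ^ i * of_nat b ^ j)"
    by (subst sum.Sigma) (auto simp: case_prod_unfold)
  also have "\<dots> = (\<Sum>(a, b, x, y)\<in>decomps n. of_nat a ^ i * of_nat b ^ j)"
    by (rule sum.reindex_bij_witness[where i = "\<lambda>(a, b, x, y). (a * x, a, b)"
          and j = "\<lambda>(m, a, b). (a, b, m div a, (n - m) div b)"])
      (auto simp: decomps_def dvd_div_eq_0_iff intro!: gr0I)
  finally show ?thesis .
qed

section \<open>Ramanujan's differential equations\<close>

lemma power_sums:
  fixes N :: nat
  assumes "1 \<le> N"
  defines "D \<equiv> of_nat N :: complex"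
  shows "(\<Sum>a = 1..<N. of_nat a) = (D^2 - D) / 2"
    and "(\<Sum>a = 1..<N. of_nat a ^ 2) = (2 * D^3 - 3 * D^2 + D) / 6"
    and "(\<Sum>a = 1..<N. of_nat a ^ 3) = (D^4 - 2 * D^3 + D^2) / 4"
    and "(\<Sum>a = 1..<N. of_nat a ^ 4) = (6 * D^5 - 15 * D^4 + 10 * D^3 - D) / 30"
    and "(\<Sum>a = 1..<N. of_nat a ^ 5) = (2 * D^6 - 6 * D^5 + 5 * D^4 - D^2) / 12"
    and "(\<Sum>a = 1..<N. of_nat a ^ 6) = (6 * D^7 - 21 * D^6 + 21 * D^5 - 7 * D^3 + D) / 42"
  unfolding D_def using assms(1)
  by (induction rule: nat_induct_at_least;
      simp add: field_simps eval_nat_numeral)+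

text \<open>Up to the sign of b, the norm form of the Eisenstein integers. The required invariances
  are the symmetries of the hexagonal lattice: permutations of a, b, -a - b and a common change of
  sign.\<close>

definition norm_form :: "int \<Rightarrow> int \<Rightarrow> int" where
  "norm_form a b = a^2 + a * b + b^2"

lemma norm_form_invariant:
  "norm_form a b = norm_form b a" "norm_form (- a) (- b) = norm_form a b"
  "norm_form a (- a - b) = norm_form a b"
  by (simp_all add: norm_form_def algebra_simps power2_eq_square)

lemma of_int_norm_form_diff:
  assumes "a < d"
  shows "(of_int (norm_form (int a) (int (d - a))) :: complex) =
    of_nat d ^ 2 - of_nat d * of_nat a + of_nat a ^ 2"
  using assms by (simp add: norm_form_def of_nat_diff algebra_simps power2_eq_square)

lemma sum_norm_form:
  assumes "0 < d"
  defines "D \<equiv> of_nat d :: complex"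
  shows "(\<Sum>a = 1..<d. of_int (norm_form (int a) (int (d - a)))) = (5 * D^3 - 6 * D^2 + D) / 6"
    and "(\<Sum>a = 1..<d. of_int (norm_form (int a) (int (d - a))) ^ 2) =
      (21 * D^5 - 30 * D^4 + 10 * D^3 - D) / 30"
    and "(\<Sum>a = 1..<d. of_int (norm_form (int a) (int (d - a))) ^ 3) =
      (249 * D^7 - 420 * D^6 + 210 * D^5 - 49 * D^3 + 10 * D) / 420"
    and "(\<Sum>a = 1..<d. of_int (int a * int (d - a) * (int a + int (d - a))) ^ 2) = (D^7 - D^3) / 30"
proof -
  have d1: "1 \<le> d" using assms by simp
  note ps = power_sums[OF d1, folded D_def]
  have c: "(\<Sum>a = 1..<d. 1) = D - 1"
    using d1 by (simp add: D_def of_nat_diff)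
  let ?n = "\<lambda>a. of_int (norm_form (int a) (int (d - a))) :: complex"
  have n: "?n a = D^2 - D * of_nat a + of_nat a ^ 2" if "a \<in> {1..<d}" for a
    using that unfolding D_def by (intro of_int_norm_form_diff) simp
  have "(\<Sum>a = 1..<d. ?n a) = (\<Sum>a = 1..<d. D^2 * 1 - D * of_nat a + of_nat a ^ 2)"
    by (rule sum.cong[OF refl]) (simp only: n mult_1_right)
  also have "\<dots> = (5 * D^3 - 6 * D^2 + D) / 6"
    unfolding sum.distrib sum_subtractf sum_distrib_left[symmetric] ps c
    by (simp add: field_simps eval_nat_numeral)
  finally show "(\<Sum>a = 1..<d. ?n a) = (5 * D^3 - 6 * D^2 + D) / 6" .
  have "(\<Sum>a = 1..<d. ?n a ^ 2) =
      (\<Sum>a = 1..<d. D^4 * 1 - 2 * D^3 * of_nat a + 3 * D^2 * of_nat a ^ 2 - 2 * D * of_nat a ^ 3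
         + of_nat a ^ 4)"
    by (rule sum.cong[OF refl], simp only: n) (simp add: algebra_simps eval_nat_numeral)
  also have "\<dots> = (21 * D^5 - 30 * D^4 + 10 * D^3 - D) / 30"
    unfolding sum.distrib sum_subtractf sum_distrib_left[symmetric] ps c
    by (simp add: field_simps eval_nat_numeral)
  finally show "(\<Sum>a = 1..<d. ?n a ^ 2) = (21 * D^5 - 30 * D^4 + 10 * D^3 - D) / 30" .
  have "(\<Sum>a = 1..<d. ?n a ^ 3) =
      (\<Sum>a = 1..<d. D^6 * 1 - 3 * D^5 * of_nat a + 6 * D^4 * of_nat a ^ 2 - 7 * D^3 * of_nat a ^ 3
         + 6 * D^2 * of_nat a ^ 4 - 3 * D * of_nat a ^ 5 + of_nat a ^ 6)"
    by (rule sum.cong[OF refl], simp only: n) (simp add: algebra_simps eval_nat_numeral)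
  also have "\<dots> = (249 * D^7 - 420 * D^6 + 210 * D^5 - 49 * D^3 + 10 * D) / 420"
    unfolding sum.distrib sum_subtractf sum_distrib_left[symmetric] ps c
    by (simp add: field_simps eval_nat_numeral)
  finally show "(\<Sum>a = 1..<d. ?n a ^ 3) =
      (249 * D^7 - 420 * D^6 + 210 * D^5 - 49 * D^3 + 10 * D) / 420" .
  have "(\<Sum>a = 1..<d. of_int (int a * int (d - a) * (int a + int (d - a))) ^ 2) =
      (\<Sum>a = 1..<d. D^4 * of_nat a ^ 2 - 2 * D^3 * of_nat a ^ 3 + D^2 * of_nat a ^ 4)"
    by (rule sum.cong[OF refl]) (simp add: D_def of_nat_diff algebra_simps eval_nat_numeral)
  also have "\<dots> = (D^7 - D^3) / 30"
    unfolding sum.distrib sum_subtractf sum_distrib_left[symmetric] ps c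
    by (simp add: field_simps eval_nat_numeral)
  finally show "(\<Sum>a = 1..<d. of_int (int a * int (d - a) * (int a + int (d - a))) ^ 2) = (D^7 - D^3) / 30" .
qed

lemma sigma_fps_nth: "sigma_fps k $ n = (\<Sum>d | d dvd n. of_nat d ^ k)"
  by (simp add: sigma_fps_def divisor_power_sum_def)

text \<open>Each summand equals n d^k - d^(k+1). The part with the factor n is what becomes the
  derivative in Ramanujan's equations.\<close>

lemma sum_divisors_quotient:
  assumes "0 < n"
  shows "(\<Sum>d | d dvd n. of_nat (n div d - 1) * (of_nat d ^ Suc k :: complex)) =
    of_nat n * sigma_fps k $ n - sigma_fps (Suc k) $ n"
proof -
  have "of_nat (n div d - 1) * (of_nat d ^ Suc k :: complex) = of_nat n * of_nat d ^ k - of_nat d ^ Suc k"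
    if "d dvd n" for d
  proof -
    have "1 \<le> n div d"
      using that assms by (simp add: Suc_le_eq div_greater_zero_iff dvd_imp_le dvd_pos_nat)
    then have "of_nat (n div d - 1) = (of_nat (n div d) - 1 :: complex)"
      by (simp add: of_nat_diff)
    moreover have "of_nat (n div d) * of_nat d = (of_nat n :: complex)"
      using that by (simp flip: of_nat_mult)
    ultimately show ?thesis
      by (simp only: power_Suc left_diff_distrib mult_1_left mult.assoc[symmetric])
  qed
  then show ?thesis
    by (simp add: sigma_fps_nth sum_subtractf sum_distrib_left)
qed

lemma sigma_fps_relation:
  fixes h :: "int \<Rightarrow> int \<Rightarrow> complex"
  assumes n: "0 < n"
    and sym: "\<And>a b. h a b = h b a" and ev: "\<And>a b. h (- a) (- b) = h a b"
    and rot: "\<And>a b. h a (- a - b) = h a b"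
    and h0: "\<And>b. h 0 b = c * of_int b ^ Suc k"
    and F: "\<And>d. 0 < d \<Longrightarrow> (\<Sum>a = 1..<d. h (int a) (int (d - a))) = F d"
  shows "(\<Sum>(a, b, x, y)\<in>decomps n. h (int a) (int b) - h (int a - int b) (int b)) =
    (\<Sum>d | d dvd n. F d) - c * (of_nat n * sigma_fps k $ n - sigma_fps (Suc k) $ n)"
proof -
  have "(\<Sum>d | d dvd n. F d) = (\<Sum>d | d dvd n. \<Sum>a = 1..<d. h (int a) (int (d - a)))"
    by (rule sum.cong[OF refl], rule F[symmetric]) (use n in \<open>auto intro: dvd_pos_nat\<close>)
  then show ?thesis
    unfolding sum_decomps_invariant[of h, OF sym ev rot] sum_decomps_eq_right sum_decomps_eq_left
    by (simp add: h0 sum_divisors_quotient[OF n, symmetric] sum_distrib_left algebra_simps)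
qed

text \<open>The invariant polynomials used are N, N^2, (a b (a + b))^2 and N^3 with N the norm form.
  Their differences under a -> a - b contain only odd powers of a and b, and the divisor sums of
  even index in the boundary terms cancel.\<close>

lemma sigma_convolutions:
  assumes "0 < n"
  defines "s \<equiv> \<lambda>k. sigma_fps k $ n"
  shows "12 * (sigma_fps 1 * sigma_fps 1) $ n = 5 * s 3 + s 1 - 6 * of_nat n * s 1"
    and "240 * (sigma_fps 1 * sigma_fps 3) $ n = 21 * s 5 + 10 * s 3 - s 1 - 30 * of_nat n * s 3"
    and "120 * (sigma_fps 3 * sigma_fps 3) $ n = s 7 - s 3"
    and "504 * (sigma_fps 1 * sigma_fps 5) $ n = 20 * s 7 + 21 * s 5 + s 1 - 42 * of_nat n * s 5"
proof -
  let ?h = "\<lambda>a b. of_int (norm_form a b) :: complex"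
  let ?T = "\<lambda>g. \<Sum>(a, b, x, y)\<in>decomps n. g (of_nat a) (of_nat b) :: complex"
  have T: "(\<Sum>t\<in>decomps n. c * (of_nat (fst t) ^ i * of_nat (fst (snd t)) ^ j)) =
      c * (sigma_fps i * sigma_fps j) $ n" for c i j
    by (simp add: sigma_fps_mult_nth case_prod_unfold sum_distrib_left)
  have S_scale: "(\<Sum>d | d dvd n. c * of_nat d ^ k) = c * s k" for c k
    by (simp add: s_def sigma_fps_nth sum_distrib_left)
  have S1: "(\<Sum>d | d dvd n. of_nat d) = s 1" "(\<Sum>d | d dvd n. c * of_nat d) = c * s 1" for c
    by (simp_all add: s_def sigma_fps_nth sum_distrib_left)
  have Sk: "(\<Sum>d | d dvd n. of_nat d ^ k) = s k" for k
    by (simp add: s_def sigma_fps_nth)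
  note S = sum.distrib sum_subtractf sum_divide_distrib[symmetric] S_scale Sk S1
  note inv = norm_form_invariant

  have "?T (\<lambda>a b. 2 * (a^1 * b^1)) =
      (\<Sum>(a, b, x, y)\<in>decomps n. ?h (int a) (int b) - ?h (int a - int b) (int b))"
    by (rule sum.cong) (auto simp: norm_form_def algebra_simps eval_nat_numeral)
  also have "\<dots> = (\<Sum>d | d dvd n. (5 * of_nat d^3 - 6 * of_nat d^2 + of_nat d) / 6)
      - 1 * (of_nat n * sigma_fps 1 $ n - sigma_fps (Suc 1) $ n)"
  proof (rule sigma_fps_relation[OF assms(1)])
    show "?h 0 b = 1 * of_int b ^ Suc 1" for b
      by (simp add: norm_form_def eval_nat_numeral)
    show "(\<Sum>a = 1..<d. ?h (int a) (int (d - a))) = (5 * of_nat d^3 - 6 * of_nat d^2 + of_nat d) / 6"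
      if "0 < d" for d
      using sum_norm_form(1)[OF that] .
  qed (simp_all only: inv)
  finally have m1: "2 * (sigma_fps 1 * sigma_fps 1) $ n = (5 * s 3 - 6 * s 2 + s 1) / 6 - (of_nat n * s 1 - s 2)"
    unfolding case_prod_unfold sum.distrib T S by (simp add: s_def eval_nat_numeral)
  show "12 * (sigma_fps 1 * sigma_fps 1) $ n = 5 * s 3 + s 1 - 6 * of_nat n * s 1"
    using m1 by (simp add: field_simps)

  have "?T (\<lambda>a b. 4 * (a^3 * b^1) + 4 * (a^1 * b^3)) =
      (\<Sum>(a, b, x, y)\<in>decomps n. ?h (int a) (int b) ^ 2 - ?h (int a - int b) (int b) ^ 2)"
    by (rule sum.cong) (auto simp: norm_form_def algebra_simps eval_nat_numeral)
  also have "\<dots> = (\<Sum>d | d dvd n. (21 * of_nat d^5 - 30 * of_nat d^4 + 10 * of_nat d^3 - of_nat d) / 30)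
      - 1 * (of_nat n * sigma_fps 3 $ n - sigma_fps (Suc 3) $ n)"
  proof (rule sigma_fps_relation[OF assms(1)])
    show "?h 0 b ^ 2 = 1 * of_int b ^ Suc 3" for b
      by (simp add: norm_form_def eval_nat_numeral)
    show "(\<Sum>a = 1..<d. ?h (int a) (int (d - a)) ^ 2) = (21 * of_nat d^5 - 30 * of_nat d^4 + 10 * of_nat d^3 - of_nat d) / 30"
      if "0 < d" for d
      using sum_norm_form(2)[OF that] .
  qed (simp_all only: inv)
  finally have m2: "4 * (sigma_fps 3 * sigma_fps 1) $ n + 4 * (sigma_fps 1 * sigma_fps 3) $ n =
      (21 * s 5 - 30 * s 4 + 10 * s 3 - s 1) / 30 - (of_nat n * s 3 - s 4)"
    unfolding case_prod_unfold sum.distrib T S by (simp add: s_def eval_nat_numeral)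
  show "240 * (sigma_fps 1 * sigma_fps 3) $ n = 21 * s 5 + 10 * s 3 - s 1 - 30 * of_nat n * s 3"
    using m2 by (simp add: field_simps mult.commute[of "sigma_fps 3"])

  let ?k = "\<lambda>a b. of_int (a * b * (a + b)) ^ 2 :: complex"
  have inv': "(a * b * (a + b))\<^sup>2 = (b * a * (b + a))\<^sup>2"
    "(- a * - b * (- a + - b))\<^sup>2 = (a * b * (a + b))\<^sup>2"
    "(a * (- a - b) * (a + (- a - b)))\<^sup>2 = (a * b * (a + b))\<^sup>2" for a b :: int
    by (simp_all add: algebra_simps power2_eq_square)
  have "?T (\<lambda>a b. 4 * (a^3 * b^3)) =
      (\<Sum>(a, b, x, y)\<in>decomps n. ?k (int a) (int b) - ?k (int a - int b) (int b))"
    by (rule sum.cong) (auto simp: algebra_simps eval_nat_numeral)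
  \<comment> \<open>Since a b (a + b) vanishes at a = 0, the boundary term has coefficient 0 and its
    exponent is arbitrary.\<close>
  also have "\<dots> = (\<Sum>d | d dvd n. (of_nat d^7 - of_nat d^3) / 30)
      - 0 * (of_nat n * sigma_fps 3 $ n - sigma_fps (Suc 3) $ n)"
  proof (rule sigma_fps_relation[OF assms(1)])
    show "(\<Sum>a = 1..<d. ?k (int a) (int (d - a))) = (of_nat d^7 - of_nat d^3) / 30" if "0 < d" for d
      using sum_norm_form(4)[OF that] .
  qed (simp_all only: inv' flip: of_int_power, simp)
  finally have m4: "4 * (sigma_fps 3 * sigma_fps 3) $ n = (s 7 - s 3) / 30"
    unfolding case_prod_unfold sum.distrib T S by simp
  show m3: "120 * (sigma_fps 3 * sigma_fps 3) $ n = s 7 - s 3"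
    using m4 by (simp add: field_simps)

  have "?T (\<lambda>a b. 6 * (a^5 * b^1) + 6 * (a^1 * b^5) + 14 * (a^3 * b^3)) =
      (\<Sum>(a, b, x, y)\<in>decomps n. ?h (int a) (int b) ^ 3 - ?h (int a - int b) (int b) ^ 3)"
    by (rule sum.cong) (auto simp: norm_form_def algebra_simps eval_nat_numeral)
  also have "\<dots> = (\<Sum>d | d dvd n. (249 * of_nat d^7 - 420 * of_nat d^6 + 210 * of_nat d^5 - 49 * of_nat d^3 + 10 * of_nat d) / 420)
      - 1 * (of_nat n * sigma_fps 5 $ n - sigma_fps (Suc 5) $ n)"
  proof (rule sigma_fps_relation[OF assms(1)])
    show "?h 0 b ^ 3 = 1 * of_int b ^ Suc 5" for b
      by (simp add: norm_form_def eval_nat_numeral)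
    show "(\<Sum>a = 1..<d. ?h (int a) (int (d - a)) ^ 3) = (249 * of_nat d^7 - 420 * of_nat d^6 + 210 * of_nat d^5 - 49 * of_nat d^3 + 10 * of_nat d) / 420"
      if "0 < d" for d
      using sum_norm_form(3)[OF that] .
  qed (simp_all only: inv)
  finally have m5: "6 * (sigma_fps 5 * sigma_fps 1) $ n + 6 * (sigma_fps 1 * sigma_fps 5) $ n
      + 14 * (sigma_fps 3 * sigma_fps 3) $ n =
      (249 * s 7 - 420 * s 6 + 210 * s 5 - 49 * s 3 + 10 * s 1) / 420 - (of_nat n * s 5 - s 6)"
    unfolding case_prod_unfold sum.distrib T S by (simp add: s_def eval_nat_numeral)
  \<comment> \<open>Multiplication by 420 turns the unwanted term with factor 14 into 5880 = 49 *
    120, which the preceding identity removes.\<close>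
  have "5040 * (sigma_fps 1 * sigma_fps 5) $ n =
      249 * s 7 + 210 * s 5 - 49 * s 3 + 10 * s 1 - 420 * of_nat n * s 5
      - 49 * (120 * (sigma_fps 3 * sigma_fps 3) $ n)"
    using m5 by (simp add: field_simps mult.commute[of "sigma_fps 5"])
  then have "10 * (504 * (sigma_fps 1 * sigma_fps 5) $ n) =
      10 * (20 * s 7 + 21 * s 5 + s 1 - 42 * of_nat n * s 5)"
    unfolding m3 by (simp add: algebra_simps)
  then show "504 * (sigma_fps 1 * sigma_fps 5) $ n = 20 * s 7 + 21 * s 5 + s 1 - 42 * of_nat n * s 5"
    by (simp only: mult_left_cancel[of "10::complex"] zero_neq_numeral[symmetric] simp_thms)
qed

text \<open>The factor 12 clears the denominators 12, 3 and 2 of Ramanujan's equations, so that the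
  Serre derivative in weight k is \<open>theta\<close> minus k times \<open>E2\<close>.\<close>

definition theta :: "complex fps \<Rightarrow> complex fps" where
  "theta f = 12 * (fps_X * fps_deriv f)"

lemma theta_nth: "theta f $ n = 12 * of_nat n * f $ n"
  by (cases n) (simp_all add: theta_def numeral_fps_const)

lemma Eisenstein_sigma:
  "E2 = 1 - 24 * sigma_fps 1" "E4 = 1 + 240 * sigma_fps 3" "E6 = 1 - 504 * sigma_fps 5"
  by (auto simp: fps_eq_iff E2_def E4_def E6_def sigma_fps_def numeral_fps_const
      divisor_power_sum_def infinite_UNIV_nat)

lemma Eisenstein_0: "E2 $ 0 = 1" "E4 $ 0 = 1" "E6 $ 0 = 1"
  by (simp_all add: E2_def E4_def E6_def)

lemma theta_E2: "theta E2 = E2^2 - E4"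
proof (rule fps_ext)
  fix n
  show "theta E2 $ n = (E2^2 - E4) $ n"
  proof (cases "n = 0")
    case True
    then show ?thesis by (simp add: theta_nth Eisenstein_0 power2_eq_square)
  next
    case False
    have "E2^2 - E4 = 48 * (12 * (sigma_fps 1 * sigma_fps 1)) - 48 * sigma_fps 1 - 240 * sigma_fps 3"
      by (simp add: Eisenstein_sigma algebra_simps power2_eq_square)
    then show ?thesis
      using False arg_cong[OF sigma_convolutions(1)[of n], of "(*) 48"]
      by (simp add: theta_nth numeral_fps_const) (simp add: Eisenstein_sigma numeral_fps_const algebra_simps)
  qed
qed

lemma theta_E4: "theta E4 = 4 * (E2 * E4 - E6)"
proof (rule fps_ext)
  fix n
  show "theta E4 $ n = (4 * (E2 * E4 - E6)) $ n"
  proof (cases "n = 0")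
    case True
    then show ?thesis by (simp add: theta_nth Eisenstein_0 numeral_fps_const power2_eq_square)
  next
    case False
    have "4 * (E2 * E4 - E6) = 960 * sigma_fps 3 - 96 * sigma_fps 1 + 2016 * sigma_fps 5
        - 96 * (240 * (sigma_fps 1 * sigma_fps 3))"
      by (simp add: Eisenstein_sigma algebra_simps)
    then show ?thesis
      using False arg_cong[OF sigma_convolutions(2)[of n], of "(*) 96"]
      by (simp add: theta_nth numeral_fps_const) (simp add: Eisenstein_sigma numeral_fps_const algebra_simps)
  qed
qed

text \<open>Both \<open>E2 * E6\<close> and \<open>E4^2\<close> bring in the divisor sums of index
  7; they cancel because 144 * 20 = 2880.\<close>

lemma theta_E6: "theta E6 = 6 * (E2 * E6 - E4^2)"
proof (rule fps_ext)
  fix n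
  show "theta E6 $ n = (6 * (E2 * E6 - E4^2)) $ n"
  proof (cases "n = 0")
    case True
    then show ?thesis by (simp add: theta_nth Eisenstein_0 numeral_fps_const power2_eq_square)
  next
    case False
    have "6 * (E2 * E6 - E4^2) = 144 * (504 * (sigma_fps 1 * sigma_fps 5)) - 144 * sigma_fps 1
        - 3024 * sigma_fps 5 - 2880 * sigma_fps 3 - 2880 * (120 * (sigma_fps 3 * sigma_fps 3))"
      by (simp add: Eisenstein_sigma algebra_simps power2_eq_square)
    then show ?thesis
      using False arg_cong[OF sigma_convolutions(3)[of n], of "(*) 2880"]
        arg_cong[OF sigma_convolutions(4)[of n], of "(*) 144"]
      by (simp add: theta_nth numeral_fps_const) (simp add: Eisenstein_sigma numeral_fps_const algebra_simps)
  qed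
qed

section \<open>The derivation \<open>12 q d/dq\<close> and modular forms\<close>

lemma theta_add: "theta (f + g) = theta f + theta g"
  by (simp add: theta_def algebra_simps)

lemma theta_0 [simp]: "theta 0 = 0"
  by (simp add: theta_def)

lemma theta_const_mult: "theta (fps_const c * f) = fps_const c * theta f"
  by (simp add: theta_def algebra_simps)

lemma theta_of_int_mult: "theta (of_int k * f) = of_int k * theta f"
  by (simp add: theta_const_mult fps_of_int[symmetric])

lemma theta_mult: "theta (f * g) = theta f * g + f * theta g"
  by (simp add: theta_def algebra_simps)

lemma theta_power: "theta (f ^ n) = of_nat n * f ^ (n - 1) * theta f"
proof (induction n)
  case 0
  then show ?case by (simp add: theta_def)
next
  case (Suc n)
  then show ?case
    by (cases n) (simp_all add: theta_mult algebra_simps)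
qed

lemma theta_fps_X_power: "theta (fps_X ^ m) = of_nat (12 * m) * fps_X ^ m"
  by (auto simp: fps_eq_iff theta_nth fps_of_nat[symmetric] simp del: of_nat_mult) simp

lemma theta_nth_0 [simp]: "theta f $ 0 = 0"
  by (simp add: theta_nth)

text \<open>\<open>\<theta>\<close> of a Laurent series has no constant term, so \<open>\<theta> (g / f)\<close> is never a non-zero
  constant.\<close>

lemma theta_wronskian_neq:
  fixes f g :: "complex fps"
  assumes "f \<noteq> 0" and "a \<noteq> 0"
  shows "theta g * f - g * theta f \<noteq> fps_const a * f^2"
proof
  assume eq: "theta g * f - g * theta f = fps_const a * f^2"
  have "g \<noteq> 0"
  proof
    assume "g = 0"
    then have "fps_const a * f^2 = 0" using eq by simp
    then show False using assms by simp
  qed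
  define s t where "s = subdegree f" and "t = subdegree g"
  define f1 g1 where "f1 = unit_factor f" and "g1 = unit_factor g"
  have f: "f = f1 * fps_X ^ s" and g: "g = g1 * fps_X ^ t"
    using subdegree_decompose[of f] subdegree_decompose[of g]
    by (simp_all add: f1_def g1_def s_def t_def fps_unit_factor_def)
  have f1: "f1 $ 0 \<noteq> 0" and g1: "g1 $ 0 \<noteq> 0"
    using \<open>f \<noteq> 0\<close> \<open>g \<noteq> 0\<close> by (simp_all add: f1_def g1_def fps_unit_factor_def)
  have "theta g * f - g * theta f =
      fps_X ^ (s + t) * (theta g1 * f1 - g1 * theta f1 + of_int (12 * (int t - int s)) * g1 * f1)"
    unfolding f g theta_mult theta_fps_X_power by (simp add: algebra_simps power_add)
  moreover have "f^2 = fps_X ^ (2 * s) * f1^2"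
    unfolding f by (simp add: algebra_simps power2_eq_square flip: power_add mult_2)
  ultimately have eq': "fps_X ^ (s + t) *
      (theta g1 * f1 - g1 * theta f1 + of_int (12 * (int t - int s)) * g1 * f1) =
      fps_X ^ (2 * s) * (fps_const a * f1^2)"
    using eq by (simp add: algebra_simps)
  define u where "u = theta g1 * f1 - g1 * theta f1 + of_int (12 * (int t - int s)) * g1 * f1"
  have u0: "u $ 0 = of_int (12 * (int t - int s)) * g1 $ 0 * f1 $ 0"
    by (simp add: u_def fps_of_int[symmetric])
  \<comment> \<open>Two coefficients suffice. For t < s the left side has a non-zero coefficient at
    s + t, below the order of the right side; for t = s its coefficient at 2 s carries the factor t
    - s = 0; for s < t it has none at 2 s, where the right side starts.\<close>
  have "(fps_X ^ (s + t) * u) $ (s + t) = (fps_X ^ (2 * s) * (fps_const a * f1^2)) $ (s + t)"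
    using eq' by (simp add: u_def)
  then have n1: "u $ 0 = (if t < s then 0 else (fps_const a * f1^2) $ (t - s))"
    by (auto simp: fps_X_power_mult_nth)
  have "(fps_X ^ (s + t) * u) $ (2 * s) = (fps_X ^ (2 * s) * (fps_const a * f1^2)) $ (2 * s)"
    using eq' by (simp add: u_def)
  then have n2: "(if s < t then 0 else u $ (s - t)) = a * (f1 $ 0)^2"
    by (auto simp: fps_X_power_mult_nth power2_eq_square split: if_splits)
  consider "t < s" | "t = s" | "s < t" by linarith
  then show False
  proof cases
    case 1
    then show False using n1 u0 f1 g1 by simp
  next
    case 2
    then show False using n1 u0 f1 \<open>a \<noteq> 0\<close> by (simp add: power2_eq_square)
  next
    case 3
    then show False using n2 f1 \<open>a \<noteq> 0\<close> by simp
  qed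
qed

section \<open>The graded ring of modular forms and the Serre derivative\<close>

lemma modular_forms_0 [simp]: "0 \<in> modular_forms k"
  by (simp add: modular_forms_def fps_vs.span_zero)

lemma modular_forms_add: "f \<in> modular_forms k \<Longrightarrow> g \<in> modular_forms k \<Longrightarrow> f + g \<in> modular_forms k"
  by (simp add: modular_forms_def fps_vs.span_add)

lemma modular_forms_diff: "f \<in> modular_forms k \<Longrightarrow> g \<in> modular_forms k \<Longrightarrow> f - g \<in> modular_forms k"
  by (simp add: modular_forms_def fps_vs.span_diff)

lemma modular_forms_scale: "f \<in> modular_forms k \<Longrightarrow> fps_const c * f \<in> modular_forms k"
  by (simp add: modular_forms_def fps_vs.span_scale)

lemma modular_forms_of_int: "f \<in> modular_forms k \<Longrightarrow> of_int c * f \<in> modular_forms k"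
  by (simp add: modular_forms_scale fps_of_int[symmetric])

lemma modular_forms_sum: "(\<And>i. i \<in> A \<Longrightarrow> f i \<in> modular_forms k) \<Longrightarrow> sum f A \<in> modular_forms k"
  by (simp add: modular_forms_def fps_vs.span_sum)

lemma modular_forms_monomial:
  "4 * int b + 6 * int c = k \<Longrightarrow> E4 ^ b * E6 ^ c \<in> modular_forms k"
  unfolding modular_forms_def by (rule fps_vs.span_base) blast

lemma modular_forms_basic: "1 \<in> modular_forms 0" "E4 \<in> modular_forms 4" "E6 \<in> modular_forms 6"
  using modular_forms_monomial[of 0 0 0] modular_forms_monomial[of 1 0 4]
    modular_forms_monomial[of 0 1 6] by simp_all

lemma modular_forms_induct [consumes 1, case_names zero add]:
  assumes "f \<in> modular_forms k" and "P 0"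
    and "\<And>c b d g. 4 * int b + 6 * int d = k \<Longrightarrow> g \<in> modular_forms k \<Longrightarrow> P g \<Longrightarrow>
      P (fps_const c * (E4 ^ b * E6 ^ d) + g)"
  shows "P f"
proof -
  have "P f \<and> f \<in> modular_forms k"
    using assms(1) unfolding modular_forms_def
  proof (induction rule: fps_vs.span_induct_alt)
    case base
    show ?case using assms(2) by (simp add: fps_vs.span_zero)
  next
    case (step c x y)
    then obtain b d where "x = E4 ^ b * E6 ^ d" "4 * int b + 6 * int d = k" by auto
    then show ?case
      using step assms(3)[of b d y c]
      by (simp add: modular_forms_def fps_vs.span_add fps_vs.span_scale fps_vs.span_base)
  qed
  then show ?thesis ..
qed

lemma modular_forms_mult:
  assumes "f \<in> modular_forms k" and "g \<in> modular_forms m"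
  shows "f * g \<in> modular_forms (k + m)"
  using assms(1)
proof (induction rule: modular_forms_induct)
  case (add c b d f)
  have "E4 ^ b * E6 ^ d * g \<in> modular_forms (k + m)"
    using assms(2)
  proof (induction rule: modular_forms_induct)
    case (add c' b' d' g)
    have "E4 ^ (b + b') * E6 ^ (d + d') \<in> modular_forms (k + m)"
      by (rule modular_forms_monomial) (use add(1) \<open>4 * int b + 6 * int d = k\<close> in simp)
    then have "fps_const c' * (E4 ^ (b + b') * E6 ^ (d + d')) + E4 ^ b * E6 ^ d * g \<in> modular_forms (k + m)"
      using add by (intro modular_forms_add modular_forms_scale)
    then show ?case by (simp add: algebra_simps power_add)
  qed simp
  then have "fps_const c * (E4 ^ b * E6 ^ d * g) + f * g \<in> modular_forms (k + m)"
    using add by (intro modular_forms_add modular_forms_scale)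
  then show ?case by (simp add: algebra_simps)
qed simp

lemma modular_forms_mult': "f \<in> modular_forms k \<Longrightarrow> g \<in> modular_forms m \<Longrightarrow> k + m = n \<Longrightarrow> f * g \<in> modular_forms n"
  using modular_forms_mult by blast

lemma modular_forms_power: "f \<in> modular_forms k \<Longrightarrow> f ^ n \<in> modular_forms (int n * k)"
proof (induction n)
  case 0
  then show ?case by (simp add: modular_forms_basic)
next
  case (Suc n)
  have "f * f ^ n \<in> modular_forms (k + int n * k)"
    using Suc.prems Suc.IH[OF Suc.prems] by (rule modular_forms_mult)
  then show ?case by (simp add: algebra_simps)
qed

lemma modular_forms_prod:
  "finite A \<Longrightarrow> (\<And>i. i \<in> A \<Longrightarrow> f i \<in> modular_forms (k i)) \<Longrightarrow> prod f A \<in> modular_forms (sum k A)"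
  by (induction A rule: finite_induct) (auto simp: modular_forms_basic intro: modular_forms_mult)

text \<open>By the product rule a monomial of exponents b, d picks up \<open>E2\<close> with the
  factor 4 b + 6 d, which is exactly its weight; the remaining terms involve \<open>E4\<close> and
  \<open>E6\<close> only.\<close>

lemma serre_derivative:
  assumes "f \<in> modular_forms k"
  shows "theta f - of_int k * E2 * f \<in> modular_forms (k + 2)"
  using assms
proof (induction rule: modular_forms_induct)
  case (add c b d f)
  define m where "m = E4 ^ b * E6 ^ d"
  \<comment> \<open>The truncated exponent at b = 0 or d = 0 is harmless, as its factor is then
    0.\<close>
  have b: "of_nat b * E4 ^ (b - 1) * E4 = of_nat b * E4 ^ b"
    "of_nat d * E6 ^ (d - 1) * E6 = of_nat d * E6 ^ d"
    by (cases b; simp) (cases d; simp)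
  have k: "of_int k = 4 * of_nat b + 6 * (of_nat d :: complex fps)"
    using add(1) by (metis of_int_add of_int_mult of_int_numeral of_int_of_nat_eq)
  have "theta m = of_nat b * E4 ^ (b - 1) * (4 * (E2 * E4 - E6)) * E6 ^ d
      + E4 ^ b * (of_nat d * E6 ^ (d - 1) * (6 * (E2 * E6 - E4^2)))"
    by (simp add: m_def theta_mult theta_power theta_E4 theta_E6)
  also have "\<dots> = 4 * E2 * E6 ^ d * (of_nat b * E4 ^ (b - 1) * E4) + 6 * E2 * E4 ^ b * (of_nat d * E6 ^ (d - 1) * E6)
       - (4 * of_nat b * (E4 ^ (b - 1) * E6 ^ (d + 1)) + 6 * of_nat d * (E4 ^ (b + 2) * E6 ^ (d - 1)))"
    by (simp add: algebra_simps power2_eq_square)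
  also have "\<dots> = of_int k * E2 * m
       - (4 * of_nat b * (E4 ^ (b - 1) * E6 ^ (d + 1)) + 6 * of_nat d * (E4 ^ (b + 2) * E6 ^ (d - 1)))"
    unfolding b k m_def by (simp add: algebra_simps)
  finally have m: "theta m - of_int k * E2 * m =
      of_int (- 4 * int b) * (E4 ^ (b - 1) * E6 ^ (d + 1)) +
      of_int (- 6 * int d) * (E4 ^ (b + 2) * E6 ^ (d - 1))"
    by simp
  have "of_int (- 4 * int b) * (E4 ^ (b - 1) * E6 ^ (d + 1)) \<in> modular_forms (k + 2)"
  proof (cases "b = 0")
    case False
    then have "E4 ^ (b - 1) * E6 ^ (d + 1) \<in> modular_forms (k + 2)"
      using add(1) by (intro modular_forms_monomial) (simp add: of_nat_diff)
    then show ?thesis by (rule modular_forms_of_int)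
  qed simp
  moreover have "of_int (- 6 * int d) * (E4 ^ (b + 2) * E6 ^ (d - 1)) \<in> modular_forms (k + 2)"
  proof (cases "d = 0")
    case False
    then have "E4 ^ (b + 2) * E6 ^ (d - 1) \<in> modular_forms (k + 2)"
      using add(1) by (intro modular_forms_monomial) (simp add: of_nat_diff)
    then show ?thesis by (rule modular_forms_of_int)
  qed simp
  ultimately have "theta m - of_int k * E2 * m \<in> modular_forms (k + 2)"
    unfolding m by (rule modular_forms_add)
  then have "fps_const c * (theta m - of_int k * E2 * m) + (theta f - of_int k * E2 * f) \<in> modular_forms (k + 2)"
    using add by (intro modular_forms_add modular_forms_scale)
  then show ?case
    by (simp add: theta_add theta_const_mult algebra_simps m_def)
qed simp

section \<open>The discriminant and the possible orders of modular forms\<close>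

definition Delta :: "complex fps" where
  "Delta = fps_const (1 / 1728) * (E4 ^ 3 - E6 ^ 2)"

lemma Delta_modular: "Delta \<in> modular_forms 12"
  unfolding Delta_def
  using modular_forms_power[OF modular_forms_basic(2), of 3] modular_forms_power[OF modular_forms_basic(3), of 2]
  by (intro modular_forms_scale modular_forms_diff) simp_all

lemma Delta_nth: "Delta $ 0 = 0" "Delta $ 1 = 1"
proof -
  \<comment> \<open>The normalisation comes from 3 * 240 + 2 * 504 = 1728.\<close>
  have "E4 $ 1 = 240" "E6 $ 1 = - 504"
    by (simp_all add: E4_def E6_def divisor_power_sum_def)
  then show "Delta $ 0 = 0" "Delta $ 1 = 1"
    by (simp_all add: Delta_def eval_nat_numeral fps_mult_nth Eisenstein_0)
qed

lemma subdegree_Delta: "subdegree Delta = 1"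
  using Delta_nth by (intro subdegreeI) auto

lemma Delta_neq_0: "Delta \<noteq> 0"
  using Delta_nth by auto

lemma E6_sq: "E6 ^ 2 = E4 ^ 3 - fps_const 1728 * Delta"
  by (simp add: Delta_def mult.assoc[symmetric])

lemma monomial_mod_Delta:
  assumes "4 * int b + 6 * int c = k"
  shows "\<exists>g\<in>modular_forms (k - 12). E4 ^ b * E6 ^ c = E4 ^ (b + 3 * (c div 2)) * E6 ^ (c mod 2) + Delta * g"
  using assms
proof (induction c arbitrary: b rule: less_induct)
  case (less c)
  show ?case
  proof (cases "c < 2")
    case True
    then show ?thesis by (intro bexI[of _ 0]) auto
  next
    case False
    then obtain e where c: "c = e + 2" by (metis add.commute le_Suc_ex not_less)
    have "4 * int (b + 3) + 6 * int e = k" using less.prems c by simp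
    then obtain g where g: "g \<in> modular_forms (k - 12)"
      "E4 ^ (b + 3) * E6 ^ e = E4 ^ (b + 3 + 3 * (e div 2)) * E6 ^ (e mod 2) + Delta * g"
      using less.IH[of e "b + 3"] c by auto
    have "E4 ^ b * E6 ^ c = E4 ^ (b + 3) * E6 ^ e - Delta * (fps_const 1728 * (E4 ^ b * E6 ^ e))"
      unfolding c power_add[of E6] power_add[of E4 b 3] E6_sq by (simp add: algebra_simps)
    also have "\<dots> = E4 ^ (b + 3 * (c div 2)) * E6 ^ (c mod 2)
        + Delta * (g - fps_const 1728 * (E4 ^ b * E6 ^ e))"
      unfolding g(2) by (simp add: c algebra_simps)
    finally show ?thesis
      using less.prems c g(1)
      by (intro bexI[of _ "g - fps_const 1728 * (E4 ^ b * E6 ^ e)"])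
        (auto intro!: modular_forms_diff modular_forms_scale modular_forms_monomial)
  qed
qed

text \<open>In a monomial of weight k the exponent of \<open>E6\<close> has the parity of k / 2.
  Once squares of \<open>E6\<close> are traded for \<open>E4 ^ 3\<close> modulo
  \<open>Delta\<close>, all monomials of weight k therefore become the same one. In a weight without
  monomials the displayed exponents mean nothing, and c = 0 is taken.\<close>

lemma modular_forms_mod_Delta:
  assumes "f \<in> modular_forms k"
  shows "\<exists>g\<in>modular_forms (k - 12). \<exists>c.
    f = fps_const c * (E4 ^ nat ((k - 6 * (k div 2 mod 2)) div 4) * E6 ^ nat (k div 2 mod 2)) + Delta * g"
  using assms
proof (induction rule: modular_forms_induct)
  case zero
  then show ?case by (intro bexI[of _ 0] exI[of _ 0]) auto
next
  case (add c b d f)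
  let ?m = "E4 ^ nat ((k - 6 * (k div 2 mod 2)) div 4) * E6 ^ nat (k div 2 mod 2)"
  obtain g where g: "g \<in> modular_forms (k - 12)"
    "E4 ^ b * E6 ^ d = E4 ^ (b + 3 * (d div 2)) * E6 ^ (d mod 2) + Delta * g"
    using monomial_mod_Delta[OF add(1)] by blast
  define e r where "e = d div 2" and "r = d mod 2"
  have "d = 2 * e + r" "r < 2"
    unfolding e_def r_def by simp_all
  then have er: "int d = 2 * int e + int r" "r < 2"
    by linarith+
  have "k div 2 = 2 * (int b + 3 * int e + int r) + int r"
    using add(1) er(1) by simp
  then have d: "k div 2 mod 2 = int r"
    using er(2) by (simp only: mod_mult_self4) simp
  have "k - 6 * (k div 2 mod 2) = 4 * int (b + 3 * e)"
    unfolding d using add(1) er(1) by simp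
  then have "(k - 6 * (k div 2 mod 2)) div 4 = int (b + 3 * e)"
    by simp
  then have n: "nat ((k - 6 * (k div 2 mod 2)) div 4) = b + 3 * e"
    by (simp only: nat_int)
  have n': "nat (k div 2 mod 2) = r"
    by (simp only: d nat_int)
  have m: "E4 ^ (b + 3 * (d div 2)) * E6 ^ (d mod 2) = ?m"
    unfolding n n' by (simp add: e_def r_def)
  obtain g' c' where g': "g' \<in> modular_forms (k - 12)" "f = fps_const c' * ?m + Delta * g'"
    using add by blast
  have "fps_const c * (E4 ^ b * E6 ^ d) + f = fps_const (c + c') * ?m + Delta * (fps_const c * g + g')"
    unfolding g(2) m g'(2) by (simp add: algebra_simps flip: fps_const_add)
  then show ?case
    using g(1) g'(1) by (blast intro: modular_forms_add modular_forms_scale)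
qed

text \<open>The constant c of the reduction modulo \<open>Delta\<close> is the constant term of the
  form. This replaces the fact that the discriminant has no zero in the upper half-plane.\<close>

lemma cusp_form_Delta:
  assumes "f \<in> modular_forms k" and "f $ 0 = 0"
  obtains g where "g \<in> modular_forms (k - 12)" and "f = Delta * g"
proof -
  obtain g c where g: "g \<in> modular_forms (k - 12)"
    "f = fps_const c * (E4 ^ nat ((k - 6 * (k div 2 mod 2)) div 4) * E6 ^ nat (k div 2 mod 2)) + Delta * g"
    using modular_forms_mod_Delta[OF assms(1)] by blast
  have "f $ 0 = c"
    unfolding g(2) by (simp add: Delta_nth fps_power_zeroth Eisenstein_0)
  then show ?thesis using that g assms(2) by simp
qed

lemma modular_forms_trivial:
  assumes "f \<in> modular_forms k" and "k < 0 \<or> odd k \<or> k = 2"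
  shows "f = 0"
  using assms(1)
proof (induction rule: modular_forms_induct)
  case (add c b d f)
  then have False using assms(2) by presburger
  then show ?case ..
qed simp

lemma dim_modular_add_12: "0 \<le> k \<Longrightarrow> even k \<Longrightarrow> dim_modular (k + 12) = Suc (dim_modular k)"
  by (simp add: dim_modular_def Suc_nat_eq_nat_zadd1 pos_imp_zdiv_nonneg_iff add.commute)

text \<open>Each division by \<open>Delta\<close> lowers the order by 1, the weight by 12 and the
  dimension by 1; it stops at a form with non-zero constant term.\<close>

lemma subdegree_less_dim_modular:
  assumes "f \<in> modular_forms k" and "f \<noteq> 0"
  shows "subdegree f < dim_modular k"
  using assms
proof (induction "nat k" arbitrary: k f rule: less_induct)
  case less
  have "\<not> (k < 0 \<or> odd k \<or> k = 2)"
    using modular_forms_trivial[OF less.prems(1)] less.prems(2) by blast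
  then have k: "0 \<le> k" "even k" "k \<noteq> 2"
    by auto
  show ?case
  proof (cases "f $ 0 = 0")
    case True
    then obtain g where g: "g \<in> modular_forms (k - 12)" "f = Delta * g"
      using cusp_form_Delta less.prems(1) by blast
    have "g \<noteq> 0" using g less.prems by auto
    then have "\<not> k - 12 < 0"
      using modular_forms_trivial[OF g(1)] by blast
    then have k12: "0 \<le> k - 12"
      by simp
    have "subdegree f = Suc (subdegree g)"
      using g(2) \<open>g \<noteq> 0\<close> Delta_neq_0 by (simp add: subdegree_Delta)
    moreover have "subdegree g < dim_modular (k - 12)"
      using less.hyps[OF _ g(1)] k12 \<open>g \<noteq> 0\<close> by simp
    moreover have "dim_modular k = Suc (dim_modular (k - 12))"
      using dim_modular_add_12[OF k12] k by simp
    ultimately show ?thesis by simp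
  next
    case False
    then have "subdegree f = 0" by simp
    moreover have "0 < dim_modular k"
      using k by (auto simp: dim_modular_def) presburger
    ultimately show ?thesis by simp
  qed
qed

text \<open>The witness is \<open>Delta ^ j\<close> times a monomial of weight m = k - 12 j. The
  bound on j makes m even, non-negative and different from 2, hence of the form 4 x + 6 y.\<close>

lemma modular_form_of_order:
  assumes "j < dim_modular k"
  shows "\<exists>f\<in>modular_forms k. f \<noteq> 0 \<and> subdegree f = j"
proof -
  define m where "m = k - 12 * int j"
  have "0 \<le> m" "even m"
    using assms by (auto simp: m_def dim_modular_def split: if_splits)
  have "m \<noteq> 2"
  proof
    assume "m = 2"
    then have "k = 2 + 12 * int j" by (simp add: m_def)
    then show False using assms by (simp add: dim_modular_def)
  qed
  define q r where "q = m div 2 div 2" and "r = m div 2 mod 2"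
  have r: "r = 0 \<or> r = 1"
    unfolding r_def by auto
  have "m = 2 * (m div 2)" "m div 2 = 2 * q + r"
    using \<open>even m\<close> unfolding q_def r_def by simp_all
  then have m: "m = 4 * q + 2 * r"
    by linarith
  with r have "r \<le> q"
    using \<open>0 \<le> m\<close> \<open>m \<noteq> 2\<close> by auto
  have "m - 6 * r = 4 * (q - r)"
    using m by simp
  then have "(m - 6 * r) div 4 = q - r"
    by simp
  then have "0 \<le> (m - 6 * r) div 4" "4 * ((m - 6 * r) div 4) + 6 * r = m"
    using \<open>r \<le> q\<close> m by simp_all
  then have "4 * int (nat ((m - 6 * (m div 2 mod 2)) div 4)) + 6 * int (nat (m div 2 mod 2)) = m"
    using r by (auto simp flip: r_def)
  then have 1: "E4 ^ nat ((m - 6 * (m div 2 mod 2)) div 4) * E6 ^ nat (m div 2 mod 2) \<in> modular_forms m"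
    (is "?e \<in> _") by (rule modular_forms_monomial)
  have "?e $ 0 \<noteq> 0"
    by (simp add: fps_power_zeroth Eisenstein_0)
  then have "subdegree ?e = 0" "?e \<noteq> 0" by (auto simp: subdegree_eq_0)
  then have "subdegree (Delta ^ j * ?e) = j" "Delta ^ j * ?e \<noteq> 0"
    using Delta_neq_0 by (simp_all add: subdegree_Delta subdegree_power)
  moreover have "Delta ^ j * ?e \<in> modular_forms k"
    by (rule modular_forms_mult'[OF modular_forms_power[OF Delta_modular] 1]) (simp add: m_def)
  ultimately show ?thesis by blast
qed

section \<open>A connection on quasi-modular forms\<close>

text \<open>Polynomials are used instead of their values at \<open>E2\<close>, since a value
  determines its coefficients only after \<open>E2\<close> is known to be transcendental.\<close>

definition modular_poly :: "nat \<Rightarrow> int \<Rightarrow> complex fps poly \<Rightarrow> bool" where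
  "modular_poly l w P \<longleftrightarrow> degree P \<le> l \<and> (\<forall>i. coeff P i \<in> modular_forms (w - 2 * int i))"

text \<open>A polynomial \<open>P\<close> over the modular forms stands for \<open>P(E2)\<close>.  This is the formal version of
  \<open>\<theta> - (w - l) E2\<close>, with \<open>X\<^sup>2 - E4\<close> for \<open>\<theta> E2\<close> and \<open>(\<theta> f - k E2 f) + k X f\<close> for \<open>\<theta> f\<close>
  when \<open>f\<close> is a coefficient of weight \<open>k\<close>; the factor \<open>w - l\<close> is the one for which the
  terms of degree \<open>l + 1\<close> cancel.\<close>

definition nabla :: "nat \<Rightarrow> int \<Rightarrow> complex fps poly \<Rightarrow> complex fps poly" where
  "nabla l w P = map_poly theta P + [:- of_int w * E2, of_nat l:] * P + [:- E4, 2 * E2, - 1:] * pderiv P"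

lemma coeff_nabla_0:
  "coeff (nabla l w P) 0 = theta (coeff P 0) - of_int w * E2 * coeff P 0 - E4 * coeff P 1"
  by (simp add: nabla_def coeff_map_poly coeff_pderiv)

lemma coeff_nabla_Suc:
  "coeff (nabla l w P) (Suc i) =
     (theta (coeff P (Suc i)) - of_int (w - 2 * int (Suc i)) * E2 * coeff P (Suc i))
     + of_int (int l - int i) * coeff P i - of_int (int i + 2) * (E4 * coeff P (Suc (Suc i)))"
  by (cases i) (simp_all add: nabla_def coeff_map_poly coeff_pderiv algebra_simps)

lemma modular_poly_nabla:
  assumes "modular_poly l w P"
  shows "modular_poly l (w + 2) (nabla l w P)"
  unfolding modular_poly_def
proof
  have c: "coeff P i \<in> modular_forms (w - 2 * int i)" for i
    using assms by (simp add: modular_poly_def)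
  have d: "coeff P i = 0" if "l < i" for i
    using assms that by (intro coeff_eq_0) (simp add: modular_poly_def)
  show "degree (nabla l w P) \<le> l"
  proof (rule degree_le, intro allI impI)
    fix i assume "l < i"
    then obtain j where i: "i = Suc j" "l \<le> j" by (cases i) auto
    have "of_int (int l - int j) * coeff P j = 0"
      using i d by (cases "j = l") auto
    then show "coeff (nabla l w P) i = 0"
      using i by (simp add: coeff_nabla_Suc d)
  qed
  show "\<forall>i. coeff (nabla l w P) i \<in> modular_forms (w + 2 - 2 * int i)"
  proof
    fix i
    have E4: "E4 * coeff P (Suc i) \<in> modular_forms (w + 2 - 2 * int i)" for i
      by (rule modular_forms_mult'[OF modular_forms_basic(2) c]) simp
    show "coeff (nabla l w P) i \<in> modular_forms (w + 2 - 2 * int i)"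
    proof (cases i)
      case 0
      show ?thesis
        using serre_derivative[OF c[of 0]] E4[of 0]
        by (simp add: 0 coeff_nabla_0 modular_forms_diff)
    next
      case (Suc j)
      have "of_int (int l - int j) * coeff P j \<in> modular_forms (w + 2 - 2 * int i)"
        using modular_forms_of_int[OF c[of j], of "int l - int j"] by (simp add: Suc)
      moreover have "of_int (int j + 2) * (E4 * coeff P (Suc i)) \<in> modular_forms (w + 2 - 2 * int i)"
        by (rule modular_forms_of_int[OF E4])
      moreover have "theta (coeff P i) - of_int (w - 2 * int i) * E2 * coeff P i \<in> modular_forms (w + 2 - 2 * int i)"
        using serre_derivative[OF c[of i]] by (simp add: algebra_simps)
      ultimately show ?thesis
        unfolding Suc coeff_nabla_Suc by (intro modular_forms_diff[OF modular_forms_add])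
    qed
  qed
qed

text \<open>The coefficients are the divided derivatives of P at \<open>E2\<close>; up to constants
  they are the components in the classical transformation law of the quasi-modular form
  \<open>poly P E2\<close>.\<close>

definition taylor_shift :: "complex fps poly \<Rightarrow> complex fps poly" where
  "taylor_shift P = pcompose P [:E2, 1:]"

lemma map_poly_theta_add: "map_poly theta (p + q) = map_poly theta p + map_poly theta q"
  by (rule poly_eqI) (simp add: coeff_map_poly theta_add)

lemma map_poly_theta_smult:
  "map_poly theta (smult c p) = smult (theta c) p + smult c (map_poly theta p)"
  by (rule poly_eqI) (simp add: coeff_map_poly theta_mult)

lemma map_poly_theta_pCons: "map_poly theta (pCons c p) = pCons (theta c) (map_poly theta p)"
  by (rule poly_eqI) (simp add: coeff_map_poly coeff_pCons split: nat.splits)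

lemma map_poly_theta_pcompose:
  "map_poly theta (pcompose p [:e, 1:]) =
     pcompose (map_poly theta p) [:e, 1:] + smult (theta e) (pcompose (pderiv p) [:e, 1:])"
proof (induction p rule: pCons_induct)
  case 0
  then show ?case by simp
next
  case (pCons a p)
  then show ?case
    by (simp add: pcompose_pCons map_poly_theta_add map_poly_theta_smult map_poly_theta_pCons
        pderiv_pCons pcompose_add algebra_simps smult_add_right)
qed

text \<open>In the variable \<open>Y = X - E2\<close> the operator no longer involves \<open>E4\<close>, and apart from \<open>\<theta>\<close> and a
  scalar it only raises the degree.\<close>

lemma taylor_shift_nabla:
  "taylor_shift (nabla l w P) = map_poly theta (taylor_shift P)
     + [:- of_int (w - int l) * E2, of_nat l:] * taylor_shift P
     + [:0, 0, - 1:] * pderiv (taylor_shift P)"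
proof -
  have 1: "pcompose [:- of_int w * E2, of_nat l:] [:E2, 1:] = [:- of_int (w - int l) * E2, of_nat l:]"
    by (simp add: pcompose_pCons algebra_simps)
  have 2: "pcompose [:- E4, 2 * E2, - 1:] [:E2, 1:] = [:E2^2 - E4, 0, - 1:]"
    by (simp add: pcompose_pCons algebra_simps power2_eq_square)
  have 3: "pderiv (taylor_shift P) = pcompose (pderiv P) [:E2, 1:]"
    by (simp add: taylor_shift_def pderiv_pcompose pderiv_pCons)
  have 4: "[:E2^2 - E4, 0, - 1:] * q = smult (E2^2 - E4) q + [:0, 0, - 1:] * q" for q
    by simp
  show ?thesis
    unfolding 3 unfolding taylor_shift_def nabla_def pcompose_add pcompose_mult 1 2 4
      map_poly_theta_pcompose theta_E2
    by (simp add: algebra_simps)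
qed

lemma coeff_taylor_shift_nabla_0:
  "coeff (taylor_shift (nabla l w P)) 0 =
     theta (coeff (taylor_shift P) 0) - of_int (w - int l) * E2 * coeff (taylor_shift P) 0"
  by (simp add: taylor_shift_nabla coeff_map_poly algebra_simps)

lemma coeff_taylor_shift_nabla_Suc:
  "coeff (taylor_shift (nabla l w P)) (Suc i) =
     theta (coeff (taylor_shift P) (Suc i)) - of_int (w - int l) * E2 * coeff (taylor_shift P) (Suc i)
     + of_int (int l - int i) * coeff (taylor_shift P) i"
  by (cases i) (simp_all add: taylor_shift_nabla coeff_map_poly coeff_pderiv algebra_simps)

lemma coeff_taylor_shift_0: "coeff (taylor_shift P) 0 = poly P E2"
  by (simp add: taylor_shift_def)

lemma pcompose_monom: "pcompose (monom c n) q = smult c (q ^ n)"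
  by (induction n) (simp_all add: monom_0 monom_Suc pcompose_pCons)

lemma coeff_taylor_shift:
  assumes "degree P \<le> l"
  shows "coeff (taylor_shift P) k = (\<Sum>i\<le>l. coeff P i * coeff ([:E2, 1:] ^ i) k)"
proof -
  have "P = (\<Sum>i\<le>l. monom (coeff P i) i)"
    using assms by (rule poly_as_sum_of_monoms'[symmetric])
  then have "taylor_shift P = taylor_shift (\<Sum>i\<le>l. monom (coeff P i) i)"
    by (rule arg_cong)
  also have "\<dots> = (\<Sum>i\<le>l. pcompose (monom (coeff P i) i) [:E2, 1:])"
    unfolding taylor_shift_def by (rule pcompose_sum)
  finally show ?thesis
    by (simp add: coeff_sum pcompose_monom)
qed

section \<open>The determinant of the iterates\<close>

fun nabla_iter :: "nat \<Rightarrow> int \<Rightarrow> complex fps poly \<Rightarrow> nat \<Rightarrow> complex fps poly" where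
  "nabla_iter l w P 0 = P"
| "nabla_iter l w P (Suc j) = nabla l (w + 2 * int j) (nabla_iter l w P j)"

lemma modular_poly_nabla_iter:
  assumes "modular_poly l w P"
  shows "modular_poly l (w + 2 * int j) (nabla_iter l w P j)"
proof (induction j)
  case (Suc j)
  show ?case using modular_poly_nabla[OF Suc] by (simp add: algebra_simps)
qed (simp add: assms)

text \<open>On values at \<open>E2\<close> the operator is \<open>theta\<close> plus multiplication
  by a series, and \<open>theta\<close> never lowers the order. Divisibility is stated because an
  iterate may vanish.\<close>

lemma order_nabla_iter:
  "fps_X ^ subdegree (poly P E2) dvd poly (nabla_iter l w P j) E2"
proof (induction j)
  case 0
  show ?case
    by (cases "poly P E2 = 0") (simp_all add: fps_dvd_iff)
next
  case (Suc j)
  let ?n = "subdegree (poly P E2)"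
  obtain g where g: "poly (nabla_iter l w P j) E2 = fps_X ^ ?n * g"
    using Suc by (elim dvdE)
  have "theta (fps_X ^ ?n * g) = fps_X ^ ?n * (theta g + of_nat (12 * ?n) * g)"
    by (simp add: theta_mult theta_fps_X_power algebra_simps)
  then show ?case
    using g by (simp add: coeff_taylor_shift_nabla_0 flip: coeff_taylor_shift_0)
qed

text \<open>The Wronskian criterion with the logarithms eliminated: the rows are the iterates of
  \<open>\<theta> + s + N\<close> with \<open>N\<close> a nilpotent shift.  A linear relation between the columns \<open>0, \<dots>, k\<close>
  that does not already hold between the columns \<open>0, \<dots>, k - 1\<close> forces \<open>\<theta> b\<close> to be a non-zero
  constant for a ratio \<open>b\<close> of its coefficients.\<close>

lemma det_cyclic_neq_0:
  fixes u :: "nat \<Rightarrow> nat \<Rightarrow> complex fps" and s :: "nat \<Rightarrow> complex fps" and a :: "nat \<Rightarrow> complex"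
  assumes u0: "u 0 0 \<noteq> 0"
    and rec0: "\<And>j. u (Suc j) 0 = theta (u j 0) + s j * u j 0"
    and recS: "\<And>j i. i < l \<Longrightarrow>
      u (Suc j) (Suc i) = theta (u j (Suc i)) + s j * u j (Suc i) + fps_const (a i) * u j i"
    and a: "\<And>i. i < l \<Longrightarrow> a i \<noteq> 0"
  shows "k \<le> l \<Longrightarrow> det (mat (Suc k) (Suc k) (\<lambda>(j, i). u j i)) \<noteq> 0"
proof (induction k)
  case 0
  show ?case using u0 by (simp add: det_single)
next
  case (Suc k)
  let ?M = "\<lambda>n. mat (Suc n) (Suc n) (\<lambda>(j, i). u j i)"
  have mult_vec: "?M n *\<^sub>v v = vec (Suc n) (\<lambda>j. \<Sum>i<Suc n. u j i * vec_index v i)"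
    if "v \<in> carrier_vec (Suc n)" for n v
    using that by (intro eq_vecI) (auto simp: scalar_prod_def lessThan_atLeast0)
  \<comment> \<open>The induction hypothesis in usable form: columns 0 to k admit no relation on
    rows 0 to k.\<close>
  have K: "d i = 0" if rel: "\<And>j. j \<le> k \<Longrightarrow> (\<Sum>i<Suc k. u j i * d i) = 0" and i: "i \<le> k" for d i
  proof -
    have "?M k *\<^sub>v vec (Suc k) d = 0\<^sub>v (Suc k)"
      unfolding mult_vec[OF vec_carrier] using rel by (intro eq_vecI) auto
    moreover have "det (?M k) \<noteq> 0"
      using Suc by simp
    ultimately have "vec (Suc k) d = 0\<^sub>v (Suc k)"
      using det_0_iff_vec_prod_zero[OF mat_carrier, of "Suc k" "\<lambda>(j, i). u j i"] vec_carrier[of "Suc k" d]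
      by blast
    then have "vec_index (vec (Suc k) d) i = vec_index (0\<^sub>v (Suc k)) i" by simp
    then show ?thesis using i by simp
  qed
  show ?case
  proof
    assume "det (?M (Suc k)) = 0"
    then obtain v where v: "v \<in> carrier_vec (Suc (Suc k))" "v \<noteq> 0\<^sub>v (Suc (Suc k))"
      "?M (Suc k) *\<^sub>v v = 0\<^sub>v (Suc (Suc k))"
      using det_0_iff_vec_prod_zero[of "?M (Suc k)" "Suc (Suc k)"] by auto
    define c where "c i = vec_index v i" for i
    have c: "(\<Sum>i<Suc (Suc k). u j i * c i) = 0" if "j \<le> Suc k" for j
      using arg_cong[OF v(3), of "\<lambda>x. vec_index x j"] that
      unfolding mult_vec[OF v(1)] by (simp add: c_def)
    have ck: "c (Suc k) \<noteq> 0"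
    proof
      assume 0: "c (Suc k) = 0"
      have "c i = 0" if "i \<le> k" for i
        by (rule K[of c, OF _ that]) (use c 0 in auto)
      with 0 have "v = 0\<^sub>v (Suc (Suc k))"
        using v(1) by (intro eq_vecI) (auto simp: c_def le_Suc_eq less_Suc_eq_le)
      then show False using v(2) by simp
    qed
    \<comment> \<open>The coefficients of a second relation: differentiate the relation
      \<open>c\<close> in row j and subtract the one in row j + 1.\<close>
    define d where "d i = (if i \<le> k then theta (c i) - fps_const (a i) * c (Suc i) else theta (c i))" for i
    have d: "(\<Sum>i<Suc (Suc k). u j i * d i) = 0" if j: "j \<le> k" for j
    proof -
      have kl: "i < l" if "i < Suc k" for i using that Suc.prems by simp
      define S T Y Z where "S = (\<Sum>i<Suc (Suc k). u j i * c i)"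
        and "T = (\<Sum>i<Suc (Suc k). theta (u j i) * c i)"
        and "Y = (\<Sum>i<Suc k. fps_const (a i) * u j i * c (Suc i))"
        and "Z = (\<Sum>i<Suc (Suc k). u j i * theta (c i))"
      have "(\<Sum>i<Suc (Suc k). u (Suc j) i * c i) =
          (\<Sum>i<Suc (Suc k). (theta (u j i) + s j * u j i) * c i) + Y"
        unfolding Y_def sum.lessThan_Suc_shift[of _ "Suc k"] rec0 using kl
        by (simp add: recS algebra_simps sum.distrib del: sum.lessThan_Suc)
      also have "(\<Sum>i<Suc (Suc k). (theta (u j i) + s j * u j i) * c i) = T + s j * S"
        unfolding S_def T_def by (simp add: algebra_simps sum.distrib sum_distrib_left)
      finally have 1: "T + s j * S + Y = 0"
        using c[of "Suc j"] j by simp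
      have S: "S = 0"
        using c[of j] j by (simp add: S_def)
      have "theta S = (\<Sum>i<Suc (Suc k). theta (u j i) * c i + u j i * theta (c i))"
        unfolding S_def by (induction k) (simp_all add: theta_add theta_mult)
      then have 2: "T + Z = 0"
        using S by (simp add: T_def Z_def sum.distrib del: sum.lessThan_Suc)
      have "(\<Sum>i<Suc (Suc k). u j i * d i) = Z - Y"
        unfolding Y_def Z_def by (simp add: d_def algebra_simps sum_subtractf)
      also have "\<dots> = (T + Z) - (T + s j * S + Y) + s j * S"
        by simp
      finally show ?thesis
        unfolding 1 2 by (simp add: S)
    qed
    \<comment> \<open>Eliminating column k + 1 between the two relations leaves one that
      \<open>K\<close> kills; its coefficient at k says that \<open>theta\<close> of the quotient of
      \<open>c k\<close> by \<open>c (Suc k)\<close> is \<open>a k\<close>.\<close>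
    have "d k * c (Suc k) - c k * d (Suc k) = 0"
    proof (rule K[of "\<lambda>i. d i * c (Suc k) - c i * d (Suc k)"])
      fix j assume j: "j \<le> k"
      have "(\<Sum>i<Suc k. u j i * (d i * c (Suc k) - c i * d (Suc k))) =
          (\<Sum>i<Suc (Suc k). u j i * d i) * c (Suc k) - (\<Sum>i<Suc (Suc k). u j i * c i) * d (Suc k)"
        by (simp add: algebra_simps sum_subtractf sum_distrib_left sum_distrib_right)
      then show "(\<Sum>i<Suc k. u j i * (d i * c (Suc k) - c i * d (Suc k))) = 0"
        using c[of j] d[of j] j by (simp del: sum.lessThan_Suc)
    qed simp
    then have "theta (c k) * c (Suc k) - c k * theta (c (Suc k)) = fps_const (a k) * (c (Suc k))^2"
      by (simp add: d_def algebra_simps power2_eq_square)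
    then show False
      using theta_wronskian_neq[OF ck a[of k]] Suc.prems by simp
  qed
qed

text \<open>In every Leibniz product the shifts 2 i and 2 p(i) cancel, because p permutes the
  indices.\<close>

lemma det_modular:
  assumes "\<And>i j. i < n \<Longrightarrow> j < n \<Longrightarrow> u i j \<in> modular_forms (k + 2 * int i - 2 * int j)"
  shows "det (mat n n (\<lambda>(i, j). u i j)) \<in> modular_forms (int n * k)"
proof -
  have "signof p * (\<Prod>i = 0..<n. mat n n (\<lambda>(i, j). u i j) $$ (i, p i)) \<in> modular_forms (int n * k)"
    if p: "p permutes {0..<n}" for p
  proof -
    have "(\<Prod>i = 0..<n. u i (p i)) \<in> modular_forms (\<Sum>i = 0..<n. k + 2 * int i - 2 * int (p i))"
      by (intro modular_forms_prod assms) (use permutes_in_image[OF p] in auto)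
    moreover have "(\<Sum>i = 0..<n. int (p i)) = (\<Sum>i = 0..<n. int i)"
      using sum.permute[OF p, of int] by (simp add: o_def)
    then have "(\<Sum>i = 0..<n. k + 2 * int i - 2 * int (p i)) = int n * k"
      by (simp add: sum.distrib sum_subtractf flip: sum_distrib_left)
    moreover have "(\<Prod>i = 0..<n. mat n n (\<lambda>(i, j). u i j) $$ (i, p i)) = (\<Prod>i = 0..<n. u i (p i))"
      by (rule prod.cong) (use permutes_in_image[OF p] in auto)
    ultimately show ?thesis
      using modular_forms_of_int[of _ "int n * k" "- 1"] by (auto simp: sign_def)
  qed
  then show ?thesis
    by (subst det_def'[of _ n]) (auto intro!: modular_forms_sum)
qed

theorem subdegree_quasi_modular:
  assumes P: "modular_poly l w P" and nz: "poly P E2 \<noteq> 0"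
  shows "subdegree (poly P E2) < dim_modular (int (Suc l) * w)"
proof -
  let ?n = "Suc l"
  define v where "v = nabla_iter l w P"
  define A where "A = mat ?n ?n (\<lambda>(j, i). coeff (v j) i)"
  define B where "B = mat ?n ?n (\<lambda>(j, i). coeff (taylor_shift (v j)) i)"
  define U where "U = mat ?n ?n (\<lambda>(i, k). coeff ([:E2, 1:] ^ i) k)"
  have carr: "A \<in> carrier_mat ?n ?n" "B \<in> carrier_mat ?n ?n" "U \<in> carrier_mat ?n ?n"
    by (simp_all add: A_def B_def U_def)
  have mod: "modular_poly l (w + 2 * int j) (v j)" for j
    unfolding v_def by (rule modular_poly_nabla_iter[OF P])
  have "B = A * U"
  proof (rule eq_matI)
    fix j k assume "j < dim_row (A * U)" "k < dim_col (A * U)"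
    then show "B $$ (j, k) = (A * U) $$ (j, k)"
      using mod[of j]
      by (simp add: A_def B_def U_def scalar_prod_def coeff_taylor_shift[of _ l] modular_poly_def
          atLeast0LessThan lessThan_Suc_atMost)
  qed (simp_all add: A_def B_def U_def)
  \<comment> \<open>Row i of \<open>U\<close> lists the coefficients of (\<open>E2\<close> + Y)^i,
    so \<open>U\<close> is lower triangular with ones on the diagonal.\<close>
  moreover have "det U = prod_list (diag_mat U)"
  proof (rule det_lower_triangular[OF _ carr(3)])
    fix i j assume "i < j" "j < Suc l"
    then have "degree ([:E2, 1:] ^ i) < j"
      using degree_power_le[of "[:E2, 1:]" i] by simp
    then show "U $$ (i, j) = 0"
      using \<open>i < j\<close> \<open>j < Suc l\<close> by (simp add: U_def coeff_eq_0)
  qed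
  moreover have "diag_mat U = map (\<lambda>i. 1) [0..<Suc l]"
    unfolding diag_mat_def by (rule map_cong) (auto simp: U_def coeff_linear_poly_power)
  then have "prod_list (diag_mat U) = 1"
    by (simp add: map_replicate_const prod_list_replicate del: upt_Suc)
  ultimately have "det B = det A"
    using det_mult[OF carr(1,3)] by simp
  moreover have "det A \<in> modular_forms (int ?n * w)"
    unfolding A_def using mod by (intro det_modular) (auto simp: modular_poly_def algebra_simps)
  ultimately have B_mod: "det B \<in> modular_forms (int ?n * w)" by simp
  have B_nz: "det B \<noteq> 0"
    unfolding B_def
  proof (rule det_cyclic_neq_0[where l = l and a = "\<lambda>i. of_int (int l - int i)"
          and s = "\<lambda>j. - of_int (w + 2 * int j - int l) * E2"])
    show "coeff (taylor_shift (v 0)) 0 \<noteq> 0"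
      using nz by (simp add: v_def coeff_taylor_shift_0)
  qed (auto simp: v_def coeff_taylor_shift_nabla_0 coeff_taylor_shift_nabla_Suc fps_of_int
      simp del: of_int_diff of_int_add)
  have "fps_X ^ subdegree (poly P E2) dvd B $$ (i, 0)" if "i < ?n" for i
    using that order_nabla_iter by (simp add: B_def coeff_taylor_shift_0 v_def)
  then have "fps_X ^ subdegree (poly P E2) dvd (\<Sum>i<?n. B $$ (i, 0) * cofactor B i 0)"
    by (intro dvd_sum dvd_mult2) auto
  then have "fps_X ^ subdegree (poly P E2) dvd det B"
    using laplace_expansion_column[OF carr(2), of 0] by simp
  then have "subdegree (poly P E2) \<le> subdegree (det B)"
    using B_nz by (simp add: fps_dvd_iff)
  also have "\<dots> < dim_modular (int ?n * w)"
    by (rule subdegree_less_dim_modular[OF B_mod B_nz])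
  finally show ?thesis .
qed

section \<open>Transcendence of \<open>E2\<close>\<close>

lemma of_int_fps_eq_0_iff: "(of_int m :: complex fps) = 0 \<longleftrightarrow> m = 0"
  by (simp flip: fps_of_int)

text \<open>The forms \<open>B\<close> for which \<open>E2 * B\<close> is again modular are closed under
  \<open>B \<mapsto> (k + 1) E2 B - \<theta> B\<close>.  In the lowest weight \<open>k\<close> in which a non-zero one exists, and in the
  eleven weights above it, such a form is determined by its constant term.  Comparing constant terms
  in weights \<open>k + 4\<close> and \<open>k + 6\<close> leads to \<open>E4^3 = E6^2\<close>.\<close>

lemma E2_mult_not_modular:
  assumes "B \<in> modular_forms k" and "E2 * B \<in> modular_forms (k + 2)"
  shows "B = 0"
  using assms
proof (induction "nat k" arbitrary: k B rule: less_induct)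
  case less
  define I where "I m = {F \<in> modular_forms m. E2 * F \<in> modular_forms (m + 2)}" for m
  have I_diff: "F - G \<in> I m" if "F \<in> I m" "G \<in> I m" for F G m
    using that by (auto simp: I_def right_diff_distrib intro: modular_forms_diff)
  have I_of_int: "of_int c * F \<in> I m" if "F \<in> I m" for c F m
    using that modular_forms_of_int[of "E2 * F" "m + 2" c]
    by (auto simp: I_def mult.left_commute intro: modular_forms_of_int)
  have I_mult: "G * F \<in> I n" if "F \<in> I m" "G \<in> modular_forms j" "j + m = n" for F G m j n
  proof -
    have "G * (E2 * F) \<in> modular_forms (n + 2)"
      using that by (intro modular_forms_mult'[of G j _ "m + 2"]) (auto simp: I_def)
    then show ?thesis
      using that by (auto simp: I_def mult.left_commute intro: modular_forms_mult')
  qed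
  show "B = 0"
  proof (rule ccontr)
    assume B: "B \<noteq> 0"
    have "\<not> (k < 0 \<or> odd k \<or> k = 2)"
      using modular_forms_trivial[OF less.prems(1)] B by blast
    then have k: "0 \<le> k" "even k" by auto
    have I0: "F = 0" if "F \<in> I m" "m < k" for F m
    proof (cases "m < 0")
      case True
      then show ?thesis using that modular_forms_trivial by (auto simp: I_def)
    next
      case False
      then show ?thesis using that less.hyps[of m F] by (simp add: I_def)
    qed
    \<comment> \<open>If F has no constant term, \<open>Delta\<close> divides both F and
      \<open>E2 * F\<close>; the quotient lies in \<open>I (m - 12)\<close>, below the minimal
      weight k.\<close>
    have vanish: "F = 0" if F: "F \<in> I m" and m: "m < k + 12" and F0: "F $ 0 = 0" for F m
    proof -
      obtain G where G: "G \<in> modular_forms (m - 12)" "F = Delta * G"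
        using cusp_form_Delta[of F m] F F0 by (auto simp: I_def)
      obtain H where H: "H \<in> modular_forms (m + 2 - 12)" "E2 * F = Delta * H"
        using cusp_form_Delta[of "E2 * F" "m + 2"] F F0 by (auto simp: I_def)
      have "Delta * (E2 * G) = Delta * H"
        using G H by (simp add: algebra_simps)
      then have "E2 * G = H" using Delta_neq_0 by simp
      moreover have "m + 2 - 12 = m - 12 + 2" by simp
      ultimately have "G \<in> I (m - 12)" using G H by (simp add: I_def)
      then show ?thesis using I0[of G "m - 12"] m G by simp
    qed
    define C where "C m F = of_int (m + 1) * E2 * F - theta F" for m F
    have C: "C m F \<in> I (m + 2)" if F: "F \<in> I m" for m F
    proof -
      have F': "F \<in> modular_forms m" "E2 * F \<in> modular_forms (m + 2)"
        using F by (auto simp: I_def)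
      have "E2 * F - (theta F - of_int m * E2 * F) \<in> modular_forms (m + 2)"
        by (rule modular_forms_diff[OF F'(2) serre_derivative[OF F'(1)]])
      moreover have "E2 * F - (theta F - of_int m * E2 * F) = C m F"
        by (simp add: C_def algebra_simps)
      moreover have "E4 * F \<in> modular_forms (m + 2 + 2)"
        by (rule modular_forms_mult'[OF modular_forms_basic(2) F'(1)]) simp
      then have "- of_int 1 * (E4 * F + (theta (E2 * F) - of_int (m + 2) * E2 * (E2 * F))) \<in> modular_forms (m + 2 + 2)"
        using modular_forms_of_int[OF modular_forms_add[OF _ serre_derivative[OF F'(2)]], of "E4 * F" "- 1"] by simp
      moreover have "- of_int 1 * (E4 * F + (theta (E2 * F) - of_int (m + 2) * E2 * (E2 * F))) = E2 * C m F"
        by (simp add: C_def theta_mult theta_E2 algebra_simps power2_eq_square)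
      ultimately show ?thesis by (simp add: I_def)
    qed
    have C_0: "C m F $ 0 = of_int (m + 1) * F $ 0" for m F
      by (simp add: C_def Eisenstein_0 fps_of_int[symmetric])
    have BI: "B \<in> I k" using less.prems by (simp add: I_def)
    define C0 C1 where "C0 = C k B" and "C1 = C (k + 2) C0"
    have C0I: "C0 \<in> I (k + 2)" and C1I: "C1 \<in> I (k + 4)"
      using C[OF BI] C[OF C[OF BI]] by (simp_all add: C0_def C1_def add.commute)
    define K where "K = (of_int k :: complex fps)"
    have "C1 - of_int ((k + 1) * (k + 3)) * (E4 * B) = 0"
    proof (rule vanish)
      show "C1 - of_int ((k + 1) * (k + 3)) * (E4 * B) \<in> I (k + 4)"
        by (intro I_diff C1I I_of_int I_mult[OF BI modular_forms_basic(2)]) simp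
      show "(C1 - of_int ((k + 1) * (k + 3)) * (E4 * B)) $ 0 = 0"
        by (simp add: C0_def C1_def C_0 Eisenstein_0 fps_of_int[symmetric] algebra_simps)
    qed simp
    then have e1: "C1 = (K + 1) * (K + 3) * (E4 * B)"
      by (simp add: K_def)
    have "E4 * C0 - of_int (k + 1) * (E6 * B) = 0"
    proof (rule vanish)
      show "E4 * C0 - of_int (k + 1) * (E6 * B) \<in> I (k + 6)"
        by (intro I_diff I_of_int I_mult[OF BI modular_forms_basic(3)] I_mult[OF C0I modular_forms_basic(2)]) simp_all
      show "(E4 * C0 - of_int (k + 1) * (E6 * B)) $ 0 = 0"
        by (simp add: C0_def C_0 Eisenstein_0 fps_of_int[symmetric])
    qed simp
    then have e2: "E4 * C0 = (K + 1) * (E6 * B)"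
      by (simp add: K_def)
    have tB: "theta B = (K + 1) * E2 * B - C0"
      by (simp add: C0_def C_def K_def)
    have tC0: "theta C0 = (K + 3) * E2 * C0 - C1"
      by (simp add: C1_def C_def K_def)
    have "theta (E4 * C0) = theta (of_int (k + 1) * (E6 * B))"
      using e2 by (simp add: K_def)
    then have "theta E4 * C0 + E4 * theta C0 = of_int (k + 1) * (theta E6 * B + E6 * theta B)"
      by (simp only: theta_mult[of E4] theta_mult[of E6] theta_of_int_mult)
    then have "4 * (E2 * E4 - E6) * C0 + E4 * ((K + 3) * E2 * C0 - C1) =
        (K + 1) * (6 * (E2 * E6 - E4^2) * B + E6 * ((K + 1) * E2 * B - C0))"
      unfolding theta_E4 theta_E6 tB tC0 by (simp add: K_def)
    then have "(K + 7) * E2 * (E4 * C0) - 4 * E6 * C0 - E4 * C1 =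
        (K + 1) * ((K + 7) * E2 * E6 * B - 6 * E4^2 * B - E6 * C0)"
      by (simp add: algebra_simps)
    then have "(K - 3) * ((K + 1) * E4^2 * B) = (K - 3) * (E6 * C0)"
      unfolding e1 e2 by (simp add: algebra_simps power2_eq_square)
    \<comment> \<open>Parity of the weight k is what permits cancelling K - 3 here and K + 1
      below.\<close>
    moreover have "K - 3 \<noteq> 0"
    proof -
      have "k - 3 \<noteq> 0" using k by presburger
      then have "(of_int (k - 3) :: complex fps) \<noteq> 0" by (simp only: of_int_fps_eq_0_iff not_False_eq_True)
      then show ?thesis by (simp add: K_def)
    qed
    ultimately have "(K + 1) * E4^2 * B = E6 * C0"
      by (metis mult_left_cancel)
    then have "E4 * ((K + 1) * E4^2 * B) = E6 * (E4 * C0)"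
      by (simp add: algebra_simps)
    then have "(K + 1) * B * E4^3 = (K + 1) * B * E6^2"
      unfolding e2 by (simp add: algebra_simps power2_eq_square power3_eq_cube)
    moreover have "K + 1 \<noteq> 0"
    proof -
      have "k + 1 \<noteq> 0" using k by presburger
      then have "(of_int (k + 1) :: complex fps) \<noteq> 0" by (simp only: of_int_fps_eq_0_iff not_False_eq_True)
      then show ?thesis by (simp add: K_def)
    qed
    ultimately have "E4^3 = E6^2" using B by simp
    then show False using Delta_neq_0 by (simp add: Delta_def)
  qed
qed

lemma coeff_taylor_shift_top:
  assumes "degree P = l"
  shows "coeff (taylor_shift P) l = coeff P l"
proof -
  have "coeff ([:E2, 1:] ^ i) l = (if i = l then 1 else 0)" if "i \<le> l" for i
    using that degree_power_le[of "[:E2, 1:]" i]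
    by (cases "i = l") (auto simp: coeff_linear_poly_power intro!: coeff_eq_0)
  then have "coeff P i * coeff ([:E2, 1:] ^ i) l = (if i = l then coeff P l else 0)" if "i \<le> l" for i
    using that by simp
  then show ?thesis
    using assms by (simp add: coeff_taylor_shift[of P l])
qed

text \<open>When this coefficient vanishes, \<open>E2\<close> times a multiple of the leading
  coefficient of P is modular, the situation excluded by \<open>E2_mult_not_modular\<close>.\<close>

lemma coeff_taylor_shift_second:
  assumes "degree P = Suc m"
  shows "coeff (taylor_shift P) m = coeff P m + of_nat (Suc m) * E2 * coeff P (Suc m)"
proof -
  have "coeff ([:E2, 1:] ^ i) m = 0" if "i < m" for i
    using that degree_power_le[of "[:E2, 1:]" i] by (intro coeff_eq_0) simp
  then have "(\<Sum>i<m. coeff P i * coeff ([:E2, 1:] ^ i) m) = 0"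
    by simp
  moreover have "coeff (taylor_shift P) m = (\<Sum>i<m. coeff P i * coeff ([:E2, 1:] ^ i) m)
      + coeff P m * coeff ([:E2, 1:] ^ m) m + coeff P (Suc m) * coeff ([:E2, 1:] ^ Suc m) m"
    using coeff_taylor_shift[of P "Suc m" m] assms
    by (simp only: lessThan_Suc_atMost[symmetric] sum.lessThan_Suc order_refl)
  moreover have "coeff ([:E2, 1:] ^ m) m = 1" "coeff ([:E2, 1:] ^ Suc m) m = of_nat (Suc m) * E2"
    by (simp_all only: coeff_linear_poly_power order_refl le_SucI binomial_n_n) (simp_all add: Suc_diff_le)
  ultimately show ?thesis
    by (simp add: algebra_simps)
qed

text \<open>For a relation P of least degree, \<open>nabla\<close> gives another one; eliminating
  the leading term forces it to be proportional to P. Let r be the lowest exponent of Y in the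
  shifted P. If r < l, rows r and r + 1 make \<open>theta\<close> of a quotient equal to r - l,
  which is impossible. If r = l, then P is a multiple of (X - \<open>E2\<close>)^l, whose two top
  coefficients cannot both be modular.\<close>

theorem E2_transcendental:
  assumes "modular_poly l w P" and "poly P E2 = 0"
  shows "P = 0"
  using assms
proof (induction "degree P" arbitrary: l w P rule: less_induct)
  case less
  show "P = 0"
  proof (rule ccontr)
    assume "P \<noteq> 0"
    \<comment> \<open>The given bound is replaced by the exact degree, so that \<open>nabla\<close>
      does not raise the degree of P.\<close>
    define l where "l = degree P"
    have mod: "modular_poly l w P"
      using less.prems(1) by (simp add: modular_poly_def l_def)
    have cP: "coeff P i \<in> modular_forms (w - 2 * int i)" for i
      using mod by (simp add: modular_poly_def)
    define c where "c = coeff P l"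
    have c: "c \<noteq> 0" using \<open>P \<noteq> 0\<close> by (simp add: c_def l_def)
    have "l \<noteq> 0"
    proof
      assume "l = 0"
      then obtain a where "P = [:a:]" by (auto simp: l_def elim: degree_eq_zeroE)
      then show False using less.prems(2) \<open>P \<noteq> 0\<close> by simp
    qed
    define Q where "Q = nabla l w P"
    have modQ: "modular_poly l (w + 2) Q"
      unfolding Q_def by (rule modular_poly_nabla[OF mod])
    have cQ: "coeff Q i \<in> modular_forms (w + 2 - 2 * int i)" for i
      using modQ by (simp add: modular_poly_def)
    have Q0: "poly Q E2 = 0"
      using less.prems(2) coeff_taylor_shift_nabla_0[of l w P]
      by (simp add: Q_def coeff_taylor_shift_0)
    define R where "R = smult c Q - smult (coeff Q l) P"
    have "degree R \<le> l"
      using modQ mod unfolding R_def modular_poly_def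
      by (intro degree_diff_le) (auto intro: order.trans[OF degree_smult_le])
    have "modular_poly l (2 * w + 2 - 2 * int l) R"
      unfolding modular_poly_def
    proof (intro conjI allI)
      fix i
      have "c * coeff Q i \<in> modular_forms (2 * w + 2 - 2 * int l - 2 * int i)"
        unfolding c_def by (rule modular_forms_mult'[OF cP cQ]) simp
      moreover have "coeff Q l * coeff P i \<in> modular_forms (2 * w + 2 - 2 * int l - 2 * int i)"
        by (rule modular_forms_mult'[OF cQ cP]) simp
      ultimately show "coeff R i \<in> modular_forms (2 * w + 2 - 2 * int l - 2 * int i)"
        by (simp add: R_def modular_forms_diff)
    qed (rule \<open>degree R \<le> l\<close>)
    moreover have "poly R E2 = 0"
      using Q0 less.prems(2) by (simp add: R_def)
    moreover have "coeff R l = 0" by (simp add: R_def c_def)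
    then have "degree R \<noteq> l" using \<open>l \<noteq> 0\<close> by (metis degree_0 leading_coeff_0_iff)
    then have "degree R < degree P" using \<open>degree R \<le> l\<close> by (simp add: l_def)
    ultimately have "R = 0" using less.hyps by blast
    define g where "g = coeff (taylor_shift P)"
    have gQ: "c * coeff (taylor_shift Q) i = coeff Q l * g i" for i
      using arg_cong[OF \<open>R = 0\<close>, of "\<lambda>R. coeff (taylor_shift R) i"]
      by (simp add: R_def g_def taylor_shift_def pcompose_diff pcompose_smult)
    have gl: "g l = c"
      unfolding g_def c_def by (rule coeff_taylor_shift_top) (simp add: l_def)
    define r where "r = (LEAST i. g i \<noteq> 0)"
    have gr: "g r \<noteq> 0" unfolding r_def by (rule LeastI[of _ l]) (use gl c in simp)
    have "r \<le> l" unfolding r_def by (rule Least_le) (use gl c in simp)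
    have g_less: "g i = 0" if "i < r" for i using that not_less_Least unfolding r_def by blast
    have g0: "g 0 = 0" using less.prems(2) by (simp add: g_def coeff_taylor_shift_0)
    then obtain r' where r': "r = Suc r'" using gr by (cases r) auto
    define s where "s = of_int (w - int l) * E2"
    have rec: "c * (theta (g (Suc i)) - s * g (Suc i) + of_int (int l - int i) * g i) = coeff Q l * g (Suc i)" for i
      using gQ[of "Suc i"] by (simp add: Q_def g_def s_def coeff_taylor_shift_nabla_Suc)
    show False
    proof (cases "r = l")
      case False
      have 1: "c * (theta (g r) - s * g r) = coeff Q l * g r"
        using rec[of r'] g_less[of r'] by (simp add: r')
      have "c * (theta (g (Suc r)) * g r - g (Suc r) * theta (g r) + of_int (int l - int r) * g r ^ 2) =
          c * (theta (g (Suc r)) - s * g (Suc r) + of_int (int l - int r) * g r) * g r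
          - c * (theta (g r) - s * g r) * g (Suc r)"
        by (simp add: algebra_simps power2_eq_square)
      also have "\<dots> = 0"
        unfolding rec 1 by simp
      finally have "theta (g (Suc r)) * g r - g (Suc r) * theta (g r) + of_int (int l - int r) * g r ^ 2 = 0"
        using c by simp
      then have "theta (g (Suc r)) * g r - g (Suc r) * theta (g r) = of_int (int r - int l) * g r ^ 2"
        by (simp add: algebra_simps add_eq_0_iff)
      moreover have "of_int (int r - int l) \<noteq> (0 :: complex)"
        using False by simp
      ultimately show False
        using theta_wronskian_neq[OF gr, of "of_int (int r - int l)" "g (Suc r)"]
        by (simp only: fps_of_int) simp
    next
      case True
      then have "degree P = Suc r'" using r' l_def by simp
      then have "g r' = coeff P r' + of_nat (Suc r') * E2 * c"
        using coeff_taylor_shift_second[of P r'] unfolding g_def c_def l_def by simp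
      then have "coeff P r' + E2 * (of_int (int (Suc r')) * c) = 0"
        using g_less[of r'] r' by (simp add: algebra_simps)
      then have "E2 * (of_int (int (Suc r')) * c) = of_int (- 1) * coeff P r'"
        by (simp only: add_eq_0_iff) simp
      moreover have wl: "w - 2 * int l + 2 = w - 2 * int r'"
        using True r' by simp
      moreover have "of_int (- 1) * coeff P r' \<in> modular_forms (w - 2 * int r')"
        by (rule modular_forms_of_int[OF cP])
      ultimately have "E2 * (of_int (int (Suc r')) * c) \<in> modular_forms (w - 2 * int l + 2)"
        unfolding wl by simp
      moreover have "of_int (int (Suc r')) * c \<in> modular_forms (w - 2 * int l)"
        unfolding c_def by (rule modular_forms_of_int[OF cP])
      ultimately have "of_int (int (Suc r')) * c = 0"
        using E2_mult_not_modular by blast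
      moreover have "(of_int (int (Suc r')) :: complex fps) \<noteq> 0"
        by (simp only: of_int_fps_eq_0_iff)
      ultimately show False using c by simp
    qed
  qed
qed

section \<open>Extremal forms\<close>

lemma underdetermined_system:
  fixes a :: "nat \<Rightarrow> nat \<Rightarrow> 'a::idom"
  assumes "0 < n"
  obtains v where "\<exists>m<n. v m \<noteq> 0" and "\<And>r. Suc r < n \<Longrightarrow> (\<Sum>m<n. a r m * v m) = 0"
proof -
  \<comment> \<open>A zero last row makes the system of n - 1 equations square with determinant
    0.\<close>
  define M where "M = mat n n (\<lambda>(r, m). if Suc r < n then a r m else 0)"
  have M: "M \<in> carrier_mat n n" by (simp add: M_def)
  have "(\<Prod>i = 0..<n. M $$ (i, p i)) = 0" if "p permutes {0..<n}" for p
    using permutes_in_image[OF that, of "n - 1"] assms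
    by (intro prod_zero bexI[of _ "n - 1"]) (auto simp: M_def)
  then have "det M = 0"
    by (subst det_def'[OF M]) (auto intro!: sum.neutral)
  then obtain v where v: "v \<in> carrier_vec n" "v \<noteq> 0\<^sub>v n" "M *\<^sub>v v = 0\<^sub>v n"
    using det_0_iff_vec_prod_zero[OF M] by blast
  have "(\<Sum>m<n. a r m * vec_index v m) = 0" if "Suc r < n" for r
    using arg_cong[OF v(3), of "\<lambda>x. vec_index x r"] that v(1)
    by (simp add: M_def scalar_prod_def atLeast0LessThan)
  moreover have "\<exists>m<n. vec_index v m \<noteq> 0"
  proof (rule ccontr)
    assume "\<not> (\<exists>m<n. vec_index v m \<noteq> 0)"
    then have "v = 0\<^sub>v n" using v(1) by (intro eq_vecI) auto
    then show False using v(2) by simp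
  qed
  ultimately show ?thesis using that by blast
qed

lemma distinct_orders_independent:
  fixes e :: "nat \<Rightarrow> complex fps"
  assumes ord: "\<And>j. j < n \<Longrightarrow> e j \<noteq> 0 \<and> subdegree (e j) = j"
    and sum: "(\<Sum>j<n. fps_const (d j) * e j) = 0" and "j < n"
  shows "d j = 0"
  using \<open>j < n\<close>
proof (induction j rule: less_induct)
  case (less j)
  have "(\<Sum>i<n. d i * e i $ j) = (\<Sum>i\<in>{j}. d i * e i $ j)"
  proof (rule sum.mono_neutral_right)
    show "\<forall>i\<in>{..<n} - {j}. d i * e i $ j = 0"
    proof
      fix i assume "i \<in> {..<n} - {j}"
      then consider "i < j" | "j < i" "i < n" by fastforce
      then show "d i * e i $ j = 0"
        using less ord[of i] by cases (auto intro: nth_less_subdegree_zero)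
    qed
  qed (use less in auto)
  moreover have "(\<Sum>i<n. d i * e i $ j) = 0"
    using arg_cong[OF sum, of "\<lambda>f. f $ j"] by (simp add: fps_sum_nth)
  moreover have "e j $ j \<noteq> 0"
    using ord[OF less.prems] nth_subdegree_nonzero by metis
  ultimately show ?case by simp
qed

lemma modular_poly_sum:
  assumes "\<And>i. i \<le> l \<Longrightarrow> g i \<in> modular_forms (w - 2 * int i)"
  defines "P \<equiv> \<Sum>i\<le>l. monom (g i) i"
  shows "modular_poly l w P" and "poly P E2 = (\<Sum>i\<le>l. g i * E2 ^ i)"
    and "i \<le> l \<Longrightarrow> coeff P i = g i"
proof -
  have c: "coeff P i = (if i \<le> l then g i else 0)" for i
    by (simp add: P_def coeff_sum)
  show "modular_poly l w P"
    unfolding modular_poly_def using assms(1) by (auto simp: c intro!: degree_le)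
  show "poly P E2 = (\<Sum>i\<le>l. g i * E2 ^ i)"
    by (simp add: P_def poly_sum poly_monom)
  show "i \<le> l \<Longrightarrow> coeff P i = g i" by (simp add: c)
qed

text \<open>Annihilating the first \<open>\<delta> l w - 1\<close> coefficients leaves one more
  unknown than equations. The polynomial is non-zero since the basis forms in each weight have
  distinct orders, and its value at \<open>E2\<close> is non-zero by transcendence.\<close>

lemma quasi_modular_form_of_high_order:
  assumes "0 < \<delta> l w"
  obtains P where "modular_poly l w P" and "P \<noteq> 0" and "\<delta> l w - 1 \<le> subdegree (poly P E2)"
proof -
  define D where "D i = dim_modular (w - 2 * int i)" for i
  define J where "J = Sigma {..l} (\<lambda>i. {..<D i})"
  have J: "finite J" "card J = \<delta> l w"
    by (simp_all add: J_def \<delta>_def D_def)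
  define e where "e i j = (SOME f. f \<in> modular_forms (w - 2 * int i) \<and> f \<noteq> 0 \<and> subdegree f = j)" for i j
  have "e i j \<in> modular_forms (w - 2 * int i) \<and> e i j \<noteq> 0 \<and> subdegree (e i j) = j" if "j < D i" for i j
    unfolding e_def by (rule someI_ex) (use modular_form_of_order that in \<open>auto simp: D_def\<close>)
  then have e: "j < D i \<Longrightarrow> e i j \<in> modular_forms (w - 2 * int i)"
    "j < D i \<Longrightarrow> e i j \<noteq> 0 \<and> subdegree (e i j) = j" for i j
    by blast+
  obtain \<phi> where \<phi>: "bij_betw \<phi> {..<\<delta> l w} J"
    using ex_bij_betw_nat_finite[OF J(1)] J(2) by (auto simp: atLeast0LessThan)
  define F where "F = (\<lambda>(i, j). e i j * E2 ^ i)"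
  obtain v where v: "\<exists>m<\<delta> l w. v m \<noteq> (0::complex)"
    "\<And>r. Suc r < \<delta> l w \<Longrightarrow> (\<Sum>m<\<delta> l w. F (\<phi> m) $ r * v m) = 0"
    using underdetermined_system[OF assms, of "\<lambda>r m. F (\<phi> m) $ r"] by blast
  define d where "d t = v (the_inv_into {..<\<delta> l w} \<phi> t)" for t
  have d: "d (\<phi> m) = v m" if "m < \<delta> l w" for m
    using that \<phi> by (simp add: d_def the_inv_into_f_f bij_betw_def)
  define g where "g i = (\<Sum>j<D i. fps_const (d (i, j)) * e i j)" for i
  define P where "P = (\<Sum>i\<le>l. monom (g i) i)"
  have g: "g i \<in> modular_forms (w - 2 * int i)" for i
    unfolding g_def using e(1) by (intro modular_forms_sum modular_forms_scale) auto
  note P = modular_poly_sum[of l g w, OF g, folded P_def]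
  have "P \<noteq> 0"
  proof
    assume "P = 0"
    obtain m where m: "m < \<delta> l w" "v m \<noteq> 0" using v(1) by blast
    obtain i j where ij: "\<phi> m = (i, j)" by fastforce
    then have "(i, j) \<in> J" using \<phi> m(1) by (metis bij_betwE lessThan_iff)
    then have "i \<le> l" "j < D i" by (auto simp: J_def)
    then have "g i = 0" using P(3) \<open>P = 0\<close> by simp
    then have "d (i, j) = 0"
      using distinct_orders_independent[of "D i" "e i" "\<lambda>j. d (i, j)"] e(2) \<open>j < D i\<close>
      unfolding g_def by blast
    then show False using d[OF m(1)] m(2) ij by simp
  qed
  moreover have "poly P E2 $ r = 0" if "r < \<delta> l w - 1" for r
  proof -
    have "poly P E2 $ r = (\<Sum>i\<le>l. \<Sum>j<D i. d (i, j) * F (i, j) $ r)"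
      unfolding P(2) g_def F_def
      by (simp add: fps_sum_nth sum_distrib_right mult.assoc)
    also have "\<dots> = (\<Sum>t\<in>J. d t * F t $ r)"
      unfolding J_def by (subst sum.Sigma) (auto simp: case_prod_unfold)
    also have "\<dots> = (\<Sum>m<\<delta> l w. d (\<phi> m) * F (\<phi> m) $ r)"
      using sum.reindex_bij_betw[OF \<phi>, of "\<lambda>t. d t * F t $ r"] by simp
    also have "\<dots> = (\<Sum>m<\<delta> l w. F (\<phi> m) $ r * v m)"
      by (rule sum.cong) (auto simp: d)
    also have "\<dots> = 0" using v(2)[of r] that by simp
    finally show ?thesis .
  qed
  then have "\<delta> l w - 1 \<le> subdegree (poly P E2)"
    using E2_transcendental[OF P(1)] \<open>P \<noteq> 0\<close> by (intro subdegree_geI) auto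
  ultimately show ?thesis using that P(1) by blast
qed

lemma quasi_modular_forms_mult_E2:
  assumes "f \<in> modular_forms k" and "k + 2 * int i = w"
  shows "f * E2 ^ i \<in> quasi_modular_forms w"
  using assms(1)
proof (induction rule: modular_forms_induct)
  case zero
  then show ?case by (simp add: quasi_modular_forms_def fps_vs.span_zero)
next
  case (add c b d f)
  have "E2 ^ i * E4 ^ b * E6 ^ d \<in> quasi_modular_forms w"
    unfolding quasi_modular_forms_def
    by (rule fps_vs.span_base) (use add(1) assms(2) in force)
  then have "fps_const c * (E2 ^ i * E4 ^ b * E6 ^ d) + f * E2 ^ i \<in> quasi_modular_forms w"
    using add(3) unfolding quasi_modular_forms_def
    by (intro fps_vs.span_add fps_vs.span_scale)
  then show ?case by (simp add: algebra_simps)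
qed

lemma modular_poly_in_quasi_modular_forms_le:
  assumes "modular_poly l w P" and "P \<noteq> 0"
  shows "poly P E2 \<in> quasi_modular_forms_le l w"
proof -
  have c: "coeff P i \<in> modular_forms (w - 2 * int i)" for i
    using assms(1) by (simp add: modular_poly_def)
  have "has_depth w (poly P E2) (degree P)"
    unfolding has_depth_def
    by (rule exI[of _ "coeff P"]) (use c assms(2) in \<open>simp add: poly_altdef\<close>)
  moreover have "poly P E2 \<in> quasi_modular_forms w"
    unfolding poly_altdef quasi_modular_forms_def
    by (intro fps_vs.span_sum, fold quasi_modular_forms_def, rule quasi_modular_forms_mult_E2[OF c]) simp
  ultimately show ?thesis
    using assms(1) by (auto simp: quasi_modular_forms_le_def modular_poly_def)
qed

lemma subdegree_less_of_depth:
  assumes "has_depth w f k" and "f \<noteq> 0"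
  shows "subdegree f < dim_modular (int (Suc k) * w)"
proof -
  obtain g where g: "\<forall>i\<le>k. g i \<in> modular_forms (w - 2 * int i)" "f = (\<Sum>i\<le>k. g i * E2 ^ i)"
    using assms(1) by (auto simp: has_depth_def)
  note P = modular_poly_sum[of k g w]
  show ?thesis
    using subdegree_quasi_modular[OF P(1)] P(2) g assms(2) by simp
qed

section \<open>The numerical comparison of dimensions\<close>

lemma dim_modular_shift:
  assumes "0 \<le> 12 * a + c" and "even c"
  shows "int (dim_modular (12 * a + c)) = a + c div 12 + (if c mod 12 = 2 then 0 else 1)"
proof -
  have "(12 * a + c) div 12 = a + c div 12" "(12 * a + c) mod 12 = c mod 12"
    by simp_all
  moreover have "0 \<le> (12 * a + c) div 12"
    using assms(1) by (simp add: pos_imp_zdiv_nonneg_iff)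
  ultimately show ?thesis
    using assms by (simp add: dim_modular_def)
qed

text \<open>For \<open>k = 5\<close> and \<open>w\<close> congruent to 10 modulo 12 the inequality fails.\<close>

lemma dim_modular_le_\<delta>:
  assumes "k \<le> 4" and "even w" and "2 * int k \<le> w"
  shows "dim_modular (int (Suc k) * w) \<le> \<delta> k w"
proof -
  define a r where "a = w div 12" and "r = w mod 12"
  have w: "w = 12 * a + r" by (simp add: a_def r_def)
  have "0 \<le> r" "r < 12" "even r"
    using assms(2) unfolding r_def by (simp_all add: dvd_mod_iff)
  then have r: "r = 0 \<or> r = 2 \<or> r = 4 \<or> r = 6 \<or> r = 8 \<or> r = 10"
    by presburger
  \<comment> \<open>The residue \<open>r - 2 * int i\<close> may be negative; flooring
    \<open>div\<close> and \<open>mod\<close> keep the formula valid, since only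
    \<open>w - 2 * int i\<close> must be non-negative.\<close>
  have "int (\<delta> k w) = (\<Sum>i\<le>k. a + (r - 2 * int i) div 12 + (if (r - 2 * int i) mod 12 = 2 then 0 else 1))"
    unfolding \<delta>_def of_nat_sum
  proof (rule sum.cong[OF refl])
    fix i assume "i \<in> {..k}"
    then show "int (dim_modular (w - 2 * int i)) =
        a + (r - 2 * int i) div 12 + (if (r - 2 * int i) mod 12 = 2 then 0 else 1)"
      using dim_modular_shift[of a "r - 2 * int i"] \<open>even r\<close> assms(3) w by (simp add: algebra_simps)
  qed
  moreover have "int (dim_modular (int (Suc k) * w)) =
      int (Suc k) * a + (int (Suc k) * r) div 12 + (if (int (Suc k) * r) mod 12 = 2 then 0 else 1)"
  proof -
    have "int (Suc k) * w = 12 * (int (Suc k) * a) + int (Suc k) * r"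
      by (simp add: w algebra_simps)
    moreover have "0 \<le> int (Suc k) * w" "even (int (Suc k) * r)"
      using assms(3) \<open>even r\<close> by simp_all
    ultimately show ?thesis
      using dim_modular_shift by metis
  qed
  \<comment> \<open>Both sides contain (k + 1) a, so only the five depths and six residues remain to
    be checked.\<close>
  moreover have "k = 0 \<or> k = 1 \<or> k = 2 \<or> k = 3 \<or> k = 4"
    using assms(1) by presburger
  then have "int (Suc k) * a + (int (Suc k) * r) div 12 + (if (int (Suc k) * r) mod 12 = 2 then 0 else 1) \<le>
      (\<Sum>i\<le>k. a + (r - 2 * int i) div 12 + (if (r - 2 * int i) mod 12 = 2 then 0 else 1))"
    using r by (elim disjE) (simp_all add: eval_nat_numeral)
  ultimately show ?thesis by linarith
qed

theorem theorem1:
  fixes l :: nat and w :: int and f :: "complex fps"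
  assumes "l \<in> {0, 1, 2, 3, 4}"
    and "even w"
    and "0 \<le> 2 * int l" and "2 * int l \<le> w"
    and "2 * int l \<noteq> w - 2"
    and "f \<in> quasi_modular_forms w"
    and "f \<noteq> 0"
    and "has_depth w f l"
  shows "algebraically_extremal l w f \<longleftrightarrow> analytically_extremal l w f"
proof -
  let ?V = "quasi_modular_forms_le l w - {0}"
  have l: "l \<le> 4" using assms(1) by auto
  \<comment> \<open>The determinant bound is applied at the actual depth k of h;
    \<open>\<delta>\<close> increases with the depth.\<close>
  have upper: "subdegree h < \<delta> l w" if h: "h \<in> ?V" for h
  proof -
    obtain k where k: "k \<le> l" "has_depth w h k"
      using h by (auto simp: quasi_modular_forms_le_def)
    have "subdegree h < dim_modular (int (Suc k) * w)"
      using k(2) h by (intro subdegree_less_of_depth) auto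
    also have "\<dots> \<le> \<delta> k w"
      using k(1) l assms(2,4) by (intro dim_modular_le_\<delta>) auto
    also have "\<dots> \<le> \<delta> l w"
      unfolding \<delta>_def using k(1) by (intro sum_mono2) auto
    finally show ?thesis .
  qed
  have "f \<in> ?V"
    using assms(6-8) by (auto simp: quasi_modular_forms_le_def)
  then have pos: "0 < \<delta> l w" using upper by fastforce
  then obtain P where P: "modular_poly l w P" "P \<noteq> 0" "\<delta> l w - 1 \<le> subdegree (poly P E2)"
    by (rule quasi_modular_form_of_high_order)
  have "poly P E2 \<in> ?V"
    using modular_poly_in_quasi_modular_forms_le[OF P(1,2)] E2_transcendental[OF P(1)] P(2) by auto
  moreover from this have "subdegree (poly P E2) = \<delta> l w - 1"
    using P(3) upper[of "poly P E2"] by linarith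
  \<comment> \<open>The strict upper bound also makes the set of orders finite, without which
    \<open>Max\<close> would be unspecified.\<close>
  ultimately have "\<nu>_max l w = \<delta> l w - 1"
    unfolding \<nu>_max_def
  proof (intro Max_eqI)
    show "finite (subdegree ` ?V)"
      by (rule finite_subset[of _ "{..<\<delta> l w}"]) (use upper in auto)
    show "n \<le> \<delta> l w - 1" if "n \<in> subdegree ` ?V" for n
      using that upper by fastforce
  qed (metis image_eqI)
  then show ?thesis
    using pos by (auto simp: algebraically_extremal_def analytically_extremal_def)
qed

end
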